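(* Let $d \geq 2$ be an integer, let $G$ be a group containing $\mathbb{Z}/d\mathbb{Z} \wr \mathbb{Z}$ as a subgroup, and let $x \in G$ be a generator for the factor $\mathbb{Z}$ of this wreath product. Let $k$ be a nonzero commutative ring with unit and let $Q$ be a ring containing $kG$ as a subring such that $1 - x$ becomes invertible in $Q$. Then $Q$ is not flat as a (left) module over $kG$.
   Context: Rings are unital and subrings share the unit. $kG$ is the group ring of $G$ over $k$. For a group $A$, $A \wr \mathbb{Z}$ denotes the (restricted) wreath product $B \rtimes \mathbb{Z}$ with base group $B = \bigoplus_{i=-\infty}^{\infty} A_i$, $A_i = A$ for all $i$, where a generator $x$ of $\mathbb{Z}$ acts by shifting: $x^i A_0 x^{-i} = A_i$. *)

theory Defs
  imports "HOL-Algebra.Algebra"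
begin

section \<open>Restricted wreath products with the integers\<close>

definition semidirect_product ::
    "('n, 'x) monoid_scheme \<Rightarrow> ('h, 'y) monoid_scheme \<Rightarrow> ('h \<Rightarrow> 'n \<Rightarrow> 'n) \<Rightarrow> ('n \<times> 'h) monoid"
  where "semidirect_product N H \<theta> =
    \<lparr>carrier = carrier N \<times> carrier H,
     monoid.mult = (\<lambda>(a, g) (b, h). (a \<otimes>\<^bsub>N\<^esub> \<theta> g b, g \<otimes>\<^bsub>H\<^esub> h)),
     one = (\<one>\<^bsub>N\<^esub>, \<one>\<^bsub>H\<^esub>)\<rparr>"

definition wreath_base :: "('a, 'x) monoid_scheme \<Rightarrow> (int \<Rightarrow> 'a) monoid"
  where "wreath_base A = sum_group UNIV (\<lambda>_. A)"

definition wreath_shift :: "int \<Rightarrow> (int \<Rightarrow> 'a) \<Rightarrow> int \<Rightarrow> 'a"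
  where "wreath_shift m b = (\<lambda>i. b (i - m))"

definition wreath_int :: "('a, 'x) monoid_scheme \<Rightarrow> ((int \<Rightarrow> 'a) \<times> int) monoid"
  where "wreath_int A = semidirect_product (wreath_base A) integer_group wreath_shift"

definition wreath_factor :: "('a, 'x) monoid_scheme \<Rightarrow> int \<Rightarrow> ((int \<Rightarrow> 'a) \<times> int) set"
  where "wreath_factor A i = {(b, 0) | b. b \<in> carrier (wreath_base A) \<and> (\<forall>j. j \<noteq> i \<longrightarrow> b j = \<one>\<^bsub>A\<^esub>)}"

lemma carrier_wreath_base:
  assumes "group A"
  shows "carrier (wreath_base A) = {b. (\<forall>i. b i \<in> carrier A) \<and> finite {i. b i \<noteq> \<one>\<^bsub>A\<^esub>}}"
  using assms by (auto simp: wreath_base_def carrier_sum_group)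

lemma wreath_shift_closed:
  assumes "group A" "b \<in> carrier (wreath_base A)"
  shows "wreath_shift m b \<in> carrier (wreath_base A)"
proof -
  have "{i. b (i - m) \<noteq> \<one>\<^bsub>A\<^esub>} = (\<lambda>i. i + m) ` {i. b i \<noteq> \<one>\<^bsub>A\<^esub>}"
    by (force simp: image_iff intro: exI[of _ "_ - m"])
  then show ?thesis
    using assms by (auto simp: carrier_wreath_base wreath_shift_def)
qed

lemma group_wreath_int:
  assumes "group A"
  shows "group (wreath_int A)"
proof -
  interpret A: group A by fact
  interpret B: group "wreath_base A"
    unfolding wreath_base_def by (simp add: assms)
  have mult: "b \<otimes>\<^bsub>wreath_base A\<^esub> c = (\<lambda>i. b i \<otimes>\<^bsub>A\<^esub> c i)" for b c
    by (simp add: wreath_base_def restrict_def)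
  have one: "\<one>\<^bsub>wreath_base A\<^esub> = (\<lambda>i. \<one>\<^bsub>A\<^esub>)"
    by (simp add: wreath_base_def restrict_def)
  have shift_mult: "wreath_shift m (b \<otimes>\<^bsub>wreath_base A\<^esub> c) =
      wreath_shift m b \<otimes>\<^bsub>wreath_base A\<^esub> wreath_shift m c" for m b c
    by (simp add: mult wreath_shift_def)
  have shift_shift: "wreath_shift m (wreath_shift n b) = wreath_shift (m + n) b" for m n b
    by (simp add: wreath_shift_def algebra_simps)
  have shift_0: "wreath_shift 0 b = b" for b
    by (simp add: wreath_shift_def)
  have shift_one: "wreath_shift m \<one>\<^bsub>wreath_base A\<^esub> = \<one>\<^bsub>wreath_base A\<^esub>" for m
    by (simp add: one wreath_shift_def)
  note closed = wreath_shift_closed[OF assms]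
  show ?thesis
  proof (rule groupI)
    fix u assume "u \<in> carrier (wreath_int A)"
    then obtain b m where u: "u = (b, m)" "b \<in> carrier (wreath_base A)"
      by (auto simp: wreath_int_def semidirect_product_def)
    have "(wreath_shift (- m) (inv\<^bsub>wreath_base A\<^esub> b), - m) \<otimes>\<^bsub>wreath_int A\<^esub> u = \<one>\<^bsub>wreath_int A\<^esub>"
      using u by (simp add: wreath_int_def semidirect_product_def shift_mult[symmetric] shift_one)
    moreover have "(wreath_shift (- m) (inv\<^bsub>wreath_base A\<^esub> b), - m) \<in> carrier (wreath_int A)"
      using u by (simp add: wreath_int_def semidirect_product_def closed)
    ultimately show "\<exists>v \<in> carrier (wreath_int A). v \<otimes>\<^bsub>wreath_int A\<^esub> u = \<one>\<^bsub>wreath_int A\<^esub>"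
      by blast
  qed (auto simp: wreath_int_def semidirect_product_def closed shift_mult shift_shift shift_0
        B.m_assoc add.assoc)
qed

lemma conj_wreath_factor:
  assumes "group A" and x: "x = (\<one>\<^bsub>wreath_base A\<^esub>, 1)"
  shows "(\<lambda>a. x [^]\<^bsub>wreath_int A\<^esub> (i::int) \<otimes>\<^bsub>wreath_int A\<^esub> a \<otimes>\<^bsub>wreath_int A\<^esub>
            inv\<^bsub>wreath_int A\<^esub> (x [^]\<^bsub>wreath_int A\<^esub> i)) ` wreath_factor A 0 = wreath_factor A i"
proof -
  interpret A: group A by fact
  interpret B: group "wreath_base A"
    unfolding wreath_base_def by (simp add: assms)
  interpret W: group "wreath_int A"
    by (rule group_wreath_int) fact
  have one: "\<one>\<^bsub>wreath_base A\<^esub> = (\<lambda>i. \<one>\<^bsub>A\<^esub>)"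
    by (simp add: wreath_base_def restrict_def)
  define e where "e = \<one>\<^bsub>wreath_base A\<^esub>"
  have e: "e \<in> carrier (wreath_base A)" "wreath_shift m e = e" for m
    using B.one_closed by (simp_all only: e_def one wreath_shift_def)
  have hom: "(\<lambda>m. (e, m)) \<in> hom integer_group (wreath_int A)"
    using e by (auto simp: hom_def wreath_int_def semidirect_product_def) (auto simp: e_def)
  have pow: "x [^]\<^bsub>wreath_int A\<^esub> i = (e, i)"
    using group_hom.hom_int_pow[of integer_group "wreath_int A" "\<lambda>m. (e, m)" 1 i] hom
    by (simp add: group_hom_def group_hom_axioms_def W.is_group x e_def)
  have inv: "inv\<^bsub>wreath_int A\<^esub> (e, i) = (e, - i)"
    using group_hom.hom_inv[of integer_group "wreath_int A" "\<lambda>m. (e, m)" i] hom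
    by (simp add: group_hom_def group_hom_axioms_def W.is_group)
  have conj: "(e, i) \<otimes>\<^bsub>wreath_int A\<^esub> (b, 0) \<otimes>\<^bsub>wreath_int A\<^esub> (e, - i) = (wreath_shift i b, 0)"
    if "b \<in> carrier (wreath_base A)" for b
    using that wreath_shift_closed[OF assms(1) that, of i] e(2)[of i]
    by (simp add: wreath_int_def semidirect_product_def) (simp add: e_def)
  have "wreath_factor A i \<subseteq> (\<lambda>b. (wreath_shift i b, 0)) `
      {b \<in> carrier (wreath_base A). \<forall>j. j \<noteq> 0 \<longrightarrow> b j = \<one>\<^bsub>A\<^esub>}"
  proof
    fix u assume "u \<in> wreath_factor A i"
    then obtain b where u: "u = (b, 0)" "b \<in> carrier (wreath_base A)" "\<And>j. j \<noteq> i \<Longrightarrow> b j = \<one>\<^bsub>A\<^esub>"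
      by (auto simp: wreath_factor_def)
    have "u = (wreath_shift i (wreath_shift (- i) b), 0)"
      by (simp add: u wreath_shift_def)
    moreover have "wreath_shift (- i) b \<in> carrier (wreath_base A)"
      using u assms(1) by (simp add: wreath_shift_closed)
    moreover have "\<forall>j. j \<noteq> 0 \<longrightarrow> wreath_shift (- i) b j = \<one>\<^bsub>A\<^esub>"
      using u by (simp add: wreath_shift_def)
    ultimately show "u \<in> (\<lambda>b. (wreath_shift i b, 0)) `
        {b \<in> carrier (wreath_base A). \<forall>j. j \<noteq> 0 \<longrightarrow> b j = \<one>\<^bsub>A\<^esub>}"
      by blast
  qed
  moreover have "(\<lambda>b. (wreath_shift i b, 0)) `
      {b \<in> carrier (wreath_base A). \<forall>j. j \<noteq> 0 \<longrightarrow> b j = \<one>\<^bsub>A\<^esub>} \<subseteq> wreath_factor A i"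
    using wreath_shift_closed[OF assms(1)] by (auto simp: wreath_factor_def) (simp add: wreath_shift_def)
  moreover have "wreath_factor A 0 = (\<lambda>b. (b, 0)) `
      {b \<in> carrier (wreath_base A). \<forall>j. j \<noteq> 0 \<longrightarrow> b j = \<one>\<^bsub>A\<^esub>}"
    by (auto simp: wreath_factor_def)
  ultimately show ?thesis
    unfolding pow inv by (auto simp: image_image conj)
qed


section \<open>Group rings\<close>

definition group_ring ::
    "('k, 'x) ring_scheme \<Rightarrow> ('g, 'y) monoid_scheme \<Rightarrow> ('g \<Rightarrow> 'k) ring"
  where "group_ring k G =
    \<lparr>carrier = {f \<in> carrier G \<rightarrow>\<^sub>E carrier k. finite {g \<in> carrier G. f g \<noteq> \<zero>\<^bsub>k\<^esub>}},
     monoid.mult = (\<lambda>f h. \<lambda>g\<in>carrier G.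
       \<Oplus>\<^bsub>k\<^esub>a\<in>{a \<in> carrier G. f a \<noteq> \<zero>\<^bsub>k\<^esub>}. (f a \<otimes>\<^bsub>k\<^esub> h (inv\<^bsub>G\<^esub> a \<otimes>\<^bsub>G\<^esub> g))),
     one = (\<lambda>g\<in>carrier G. if g = \<one>\<^bsub>G\<^esub> then \<one>\<^bsub>k\<^esub> else \<zero>\<^bsub>k\<^esub>),
     ring.zero = (\<lambda>g\<in>carrier G. \<zero>\<^bsub>k\<^esub>),
     ring.add = (\<lambda>f h. \<lambda>g\<in>carrier G. f g \<oplus>\<^bsub>k\<^esub> h g)\<rparr>"

definition group_ring_of ::
    "('k, 'x) ring_scheme \<Rightarrow> ('g, 'y) monoid_scheme \<Rightarrow> 'g \<Rightarrow> 'g \<Rightarrow> 'k"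
  where "group_ring_of k G x = (\<lambda>g\<in>carrier G. if g = x then \<one>\<^bsub>k\<^esub> else \<zero>\<^bsub>k\<^esub>)"

lemma ring_group_ring:
  assumes "ring k" "group G"
  shows "ring (group_ring k G)"
proof -
  interpret k: ring k by fact
  interpret G: group G by fact
  define supp where "supp f = {g \<in> carrier G. f g \<noteq> \<zero>\<^bsub>k\<^esub>}" for f
  have carrierI: "f \<in> carrier (group_ring k G)"
    if "f \<in> carrier G \<rightarrow>\<^sub>E carrier k" "supp f \<subseteq> S" "finite S" for f S
    using that finite_subset by (auto simp: group_ring_def supp_def)
  have closed: "f g \<in> carrier k" if "f \<in> carrier (group_ring k G)" "g \<in> carrier G" for f g
    using that by (auto simp: group_ring_def)
  have fin: "finite (supp f)" if "f \<in> carrier (group_ring k G)" for f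
    using that by (auto simp: group_ring_def supp_def)
  have supp_sub: "supp f \<subseteq> carrier G" for f
    by (auto simp: supp_def)
  have ext: "f = h" if "f \<in> carrier (group_ring k G)" "h \<in> carrier (group_ring k G)"
    "\<And>g. g \<in> carrier G \<Longrightarrow> f g = h g" for f h
    using that by (auto simp: group_ring_def intro: PiE_ext)
  have mult: "(f \<otimes>\<^bsub>group_ring k G\<^esub> h) g =
      (\<Oplus>\<^bsub>k\<^esub>a\<in>S. f a \<otimes>\<^bsub>k\<^esub> h (inv\<^bsub>G\<^esub> a \<otimes>\<^bsub>G\<^esub> g))"
    if "f \<in> carrier (group_ring k G)" "h \<in> carrier (group_ring k G)" "g \<in> carrier G"
      "supp f \<subseteq> S" "finite S" "S \<subseteq> carrier G" for f h g S
  proof -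
    have "(\<Oplus>\<^bsub>k\<^esub>a\<in>supp f. f a \<otimes>\<^bsub>k\<^esub> h (inv\<^bsub>G\<^esub> a \<otimes>\<^bsub>G\<^esub> g)) =
        (\<Oplus>\<^bsub>k\<^esub>a\<in>S. f a \<otimes>\<^bsub>k\<^esub> h (inv\<^bsub>G\<^esub> a \<otimes>\<^bsub>G\<^esub> g))"
    proof (rule k.add.finprod_mono_neutral_cong_left[OF \<open>finite S\<close> \<open>supp f \<subseteq> S\<close>])
      fix a assume "a \<in> S - supp f"
      then have "a \<in> carrier G" "f a = \<zero>\<^bsub>k\<^esub>"
        using that by (auto simp: supp_def)
      then show "f a \<otimes>\<^bsub>k\<^esub> h (inv\<^bsub>G\<^esub> a \<otimes>\<^bsub>G\<^esub> g) = \<zero>\<^bsub>k\<^esub>"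
        using that by (simp add: closed)
    qed (use that in \<open>auto simp: subset_iff closed\<close>)
    then show ?thesis
      using that by (simp add: group_ring_def supp_def)
  qed
  have mult_closed: "f \<otimes>\<^bsub>group_ring k G\<^esub> h \<in> carrier (group_ring k G)"
    if f: "f \<in> carrier (group_ring k G)" and h: "h \<in> carrier (group_ring k G)" for f h
  proof (rule carrierI)
    show "f \<otimes>\<^bsub>group_ring k G\<^esub> h \<in> carrier G \<rightarrow>\<^sub>E carrier k"
      using f h by (auto simp: group_ring_def intro!: k.finsum_closed)
    show "finite ((\<lambda>(a, c). a \<otimes>\<^bsub>G\<^esub> c) ` (supp f \<times> supp h))"
      using f h by (simp add: fin)
    show "supp (f \<otimes>\<^bsub>group_ring k G\<^esub> h) \<subseteq> (\<lambda>(a, c). a \<otimes>\<^bsub>G\<^esub> c) ` (supp f \<times> supp h)"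
    proof (rule subsetI, rule ccontr)
      fix g assume g: "g \<in> supp (f \<otimes>\<^bsub>group_ring k G\<^esub> h)"
        and not: "g \<notin> (\<lambda>(a, c). a \<otimes>\<^bsub>G\<^esub> c) ` (supp f \<times> supp h)"
      have gG: "g \<in> carrier G" using g by (simp add: supp_def)
      have "f a \<otimes>\<^bsub>k\<^esub> h (inv\<^bsub>G\<^esub> a \<otimes>\<^bsub>G\<^esub> g) = \<zero>\<^bsub>k\<^esub>" if a: "a \<in> supp f" for a
      proof -
        have aG: "a \<in> carrier G" using a by (simp add: supp_def)
        have "g = a \<otimes>\<^bsub>G\<^esub> (inv\<^bsub>G\<^esub> a \<otimes>\<^bsub>G\<^esub> g)"
          using aG gG by (simp flip: G.m_assoc)
        then have "inv\<^bsub>G\<^esub> a \<otimes>\<^bsub>G\<^esub> g \<notin> supp h"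
          using not a by force
        then show ?thesis
          using aG gG f by (simp add: supp_def closed)
      qed
      then have "(f \<otimes>\<^bsub>group_ring k G\<^esub> h) g = \<zero>\<^bsub>k\<^esub>"
        using mult[OF f h gG subset_refl] f by (simp add: fin supp_sub k.add.finprod_one_eqI)
      then show False using g by (simp add: supp_def)
    qed
  qed
  have swap: "(\<Oplus>\<^bsub>k\<^esub>a\<in>A. \<Oplus>\<^bsub>k\<^esub>b\<in>B. F a b) = (\<Oplus>\<^bsub>k\<^esub>b\<in>B. \<Oplus>\<^bsub>k\<^esub>a\<in>A. F a b)"
    if "finite A" "finite B" "\<And>a b. a \<in> A \<Longrightarrow> b \<in> B \<Longrightarrow> F a b \<in> carrier k"
    for A B :: "'c set" and F
    using that
  proof (induction A rule: finite_induct)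
    case (insert x A)
    have "(\<Oplus>\<^bsub>k\<^esub>a\<in>insert x A. \<Oplus>\<^bsub>k\<^esub>b\<in>B. F a b) =
        (\<Oplus>\<^bsub>k\<^esub>b\<in>B. F x b) \<oplus>\<^bsub>k\<^esub> (\<Oplus>\<^bsub>k\<^esub>a\<in>A. \<Oplus>\<^bsub>k\<^esub>b\<in>B. F a b)"
      using insert by (subst k.finsum_insert) (auto intro!: k.finsum_closed)
    also have "\<dots> = (\<Oplus>\<^bsub>k\<^esub>b\<in>B. F x b) \<oplus>\<^bsub>k\<^esub> (\<Oplus>\<^bsub>k\<^esub>b\<in>B. \<Oplus>\<^bsub>k\<^esub>a\<in>A. F a b)"
      using insert by simp
    also have "\<dots> = (\<Oplus>\<^bsub>k\<^esub>b\<in>B. F x b \<oplus>\<^bsub>k\<^esub> (\<Oplus>\<^bsub>k\<^esub>a\<in>A. F a b))"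
      using insert by (subst k.finsum_addf) (auto intro!: k.finsum_closed)
    also have "\<dots> = (\<Oplus>\<^bsub>k\<^esub>b\<in>B. \<Oplus>\<^bsub>k\<^esub>a\<in>insert x A. F a b)"
    proof (rule k.finsum_cong')
      fix b assume "b \<in> B"
      then show "F x b \<oplus>\<^bsub>k\<^esub> (\<Oplus>\<^bsub>k\<^esub>a\<in>A. F a b) = (\<Oplus>\<^bsub>k\<^esub>a\<in>insert x A. F a b)"
        using insert by (subst k.finsum_insert) auto
    qed (use insert in \<open>auto intro!: k.finsum_closed\<close>)
    finally show ?case .
  qed simp
  have mult_assoc: "f \<otimes>\<^bsub>group_ring k G\<^esub> h \<otimes>\<^bsub>group_ring k G\<^esub> l =
      f \<otimes>\<^bsub>group_ring k G\<^esub> (h \<otimes>\<^bsub>group_ring k G\<^esub> l)"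
    if f: "f \<in> carrier (group_ring k G)" and h: "h \<in> carrier (group_ring k G)"
      and l: "l \<in> carrier (group_ring k G)" for f h l
  proof (rule ext)
    fix g assume g: "g \<in> carrier G"
    define T where "T = (\<lambda>(a, c). a \<otimes>\<^bsub>G\<^esub> c) ` (supp f \<times> supp h) \<union> supp (f \<otimes>\<^bsub>group_ring k G\<^esub> h)"
    have T: "finite T" "supp (f \<otimes>\<^bsub>group_ring k G\<^esub> h) \<subseteq> T"
      using f h mult_closed[OF f h] by (auto simp: T_def intro!: fin)
    have T3: "T \<subseteq> carrier G"
      by (auto simp: T_def supp_def)
    note T = T T3
    have inG: "a \<in> carrier G" if "a \<in> T \<or> a \<in> supp f \<or> a \<in> supp h" for a
      using that T by (auto simp: supp_def)
    have "(f \<otimes>\<^bsub>group_ring k G\<^esub> h \<otimes>\<^bsub>group_ring k G\<^esub> l) g =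
        (\<Oplus>\<^bsub>k\<^esub>b\<in>T. (f \<otimes>\<^bsub>group_ring k G\<^esub> h) b \<otimes>\<^bsub>k\<^esub> l (inv\<^bsub>G\<^esub> b \<otimes>\<^bsub>G\<^esub> g))"
      by (rule mult[OF mult_closed[OF f h] l g T(2,1,3)])
    also have "\<dots> = (\<Oplus>\<^bsub>k\<^esub>b\<in>T. \<Oplus>\<^bsub>k\<^esub>a\<in>supp f.
        f a \<otimes>\<^bsub>k\<^esub> h (inv\<^bsub>G\<^esub> a \<otimes>\<^bsub>G\<^esub> b) \<otimes>\<^bsub>k\<^esub> l (inv\<^bsub>G\<^esub> b \<otimes>\<^bsub>G\<^esub> g))"
    proof (rule k.finsum_cong')
      fix b assume b: "b \<in> T"
      show "(f \<otimes>\<^bsub>group_ring k G\<^esub> h) b \<otimes>\<^bsub>k\<^esub> l (inv\<^bsub>G\<^esub> b \<otimes>\<^bsub>G\<^esub> g) = (\<Oplus>\<^bsub>k\<^esub>a\<in>supp f.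
          f a \<otimes>\<^bsub>k\<^esub> h (inv\<^bsub>G\<^esub> a \<otimes>\<^bsub>G\<^esub> b) \<otimes>\<^bsub>k\<^esub> l (inv\<^bsub>G\<^esub> b \<otimes>\<^bsub>G\<^esub> g))"
        unfolding mult[OF f h inG[OF disjI1[OF b]] subset_refl fin[OF f] supp_sub]
        using b g by (intro k.finsum_ldistr) (auto simp: fin f h l closed inG)
    qed (use g in \<open>auto intro!: k.finsum_closed simp: f h l closed inG\<close>)
    also have "\<dots> = (\<Oplus>\<^bsub>k\<^esub>a\<in>supp f. \<Oplus>\<^bsub>k\<^esub>b\<in>T.
        f a \<otimes>\<^bsub>k\<^esub> h (inv\<^bsub>G\<^esub> a \<otimes>\<^bsub>G\<^esub> b) \<otimes>\<^bsub>k\<^esub> l (inv\<^bsub>G\<^esub> b \<otimes>\<^bsub>G\<^esub> g))"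
      using g by (intro swap T fin f) (auto simp: f h l closed inG)
    also have "\<dots> = (\<Oplus>\<^bsub>k\<^esub>a\<in>supp f.
        f a \<otimes>\<^bsub>k\<^esub> (h \<otimes>\<^bsub>group_ring k G\<^esub> l) (inv\<^bsub>G\<^esub> a \<otimes>\<^bsub>G\<^esub> g))"
    proof (rule k.finsum_cong')
      fix a assume a: "a \<in> supp f"
      have aG: "a \<in> carrier G" using a by (simp add: inG)
      define t where "t = (\<lambda>c. f a \<otimes>\<^bsub>k\<^esub> (h c \<otimes>\<^bsub>k\<^esub> l (inv\<^bsub>G\<^esub> c \<otimes>\<^bsub>G\<^esub> (inv\<^bsub>G\<^esub> a \<otimes>\<^bsub>G\<^esub> g))))"
      define F where "F = (\<lambda>b. f a \<otimes>\<^bsub>k\<^esub> h (inv\<^bsub>G\<^esub> a \<otimes>\<^bsub>G\<^esub> b) \<otimes>\<^bsub>k\<^esub> l (inv\<^bsub>G\<^esub> b \<otimes>\<^bsub>G\<^esub> g))"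
      have "(\<Oplus>\<^bsub>k\<^esub>b\<in>(\<lambda>c. a \<otimes>\<^bsub>G\<^esub> c) ` supp h. F b) = (\<Oplus>\<^bsub>k\<^esub>b\<in>T. F b)"
      proof (rule k.add.finprod_mono_neutral_cong_left)
        show "(\<lambda>c. a \<otimes>\<^bsub>G\<^esub> c) ` supp h \<subseteq> T"
          using a by (auto simp: T_def)
      next
        fix b assume b: "b \<in> T - (\<lambda>c. a \<otimes>\<^bsub>G\<^esub> c) ` supp h"
        then have bG: "b \<in> carrier G" by (simp add: inG)
        have "b = a \<otimes>\<^bsub>G\<^esub> (inv\<^bsub>G\<^esub> a \<otimes>\<^bsub>G\<^esub> b)"
          using aG bG by (simp flip: G.m_assoc)
        then have "inv\<^bsub>G\<^esub> a \<otimes>\<^bsub>G\<^esub> b \<notin> supp h"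
          using b by blast
        then have "h (inv\<^bsub>G\<^esub> a \<otimes>\<^bsub>G\<^esub> b) = \<zero>\<^bsub>k\<^esub>"
          using aG bG by (simp add: supp_def)
        then show "F b = \<zero>\<^bsub>k\<^esub>"
          using aG bG g by (simp add: F_def closed f l)
      qed (use T a g aG in \<open>auto simp: F_def f h l closed inG\<close>)
      moreover have "(\<Oplus>\<^bsub>k\<^esub>b\<in>(\<lambda>c. a \<otimes>\<^bsub>G\<^esub> c) ` supp h. F b) = (\<Oplus>\<^bsub>k\<^esub>c\<in>supp h. F (a \<otimes>\<^bsub>G\<^esub> c))"
        using aG g by (intro k.add.finprod_reindex)
          (auto simp: F_def inj_on_def f h l closed inG)
      moreover have "(\<Oplus>\<^bsub>k\<^esub>c\<in>supp h. F (a \<otimes>\<^bsub>G\<^esub> c)) = (\<Oplus>\<^bsub>k\<^esub>c\<in>supp h. t c)"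
      proof (rule k.finsum_cong')
        fix c assume "c \<in> supp h"
        then have c: "c \<in> carrier G" by (simp add: inG)
        have "inv\<^bsub>G\<^esub> a \<otimes>\<^bsub>G\<^esub> (a \<otimes>\<^bsub>G\<^esub> c) = c"
          using aG c by (simp flip: G.m_assoc)
        then show "F (a \<otimes>\<^bsub>G\<^esub> c) = t c"
          using aG c g by (simp add: F_def t_def G.inv_mult_group G.m_assoc k.m_assoc closed f h l)
      qed (use aG g in \<open>auto simp: t_def f h l closed inG\<close>)
      moreover have "(\<Oplus>\<^bsub>k\<^esub>c\<in>supp h. t c) =
          f a \<otimes>\<^bsub>k\<^esub> (h \<otimes>\<^bsub>group_ring k G\<^esub> l) (inv\<^bsub>G\<^esub> a \<otimes>\<^bsub>G\<^esub> g)"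
        unfolding t_def using aG g
        by (subst mult[OF h l _ subset_refl fin[OF h] supp_sub])
          (auto intro!: k.finsum_rdistr[symmetric] simp: fin f h l closed inG)
      ultimately show "(\<Oplus>\<^bsub>k\<^esub>b\<in>T.
          f a \<otimes>\<^bsub>k\<^esub> h (inv\<^bsub>G\<^esub> a \<otimes>\<^bsub>G\<^esub> b) \<otimes>\<^bsub>k\<^esub> l (inv\<^bsub>G\<^esub> b \<otimes>\<^bsub>G\<^esub> g)) =
          f a \<otimes>\<^bsub>k\<^esub> (h \<otimes>\<^bsub>group_ring k G\<^esub> l) (inv\<^bsub>G\<^esub> a \<otimes>\<^bsub>G\<^esub> g)"
        by (simp add: F_def)
    qed (use g in \<open>auto simp: mult_closed f h l closed inG\<close>)
    also have "\<dots> = (f \<otimes>\<^bsub>group_ring k G\<^esub> (h \<otimes>\<^bsub>group_ring k G\<^esub> l)) g"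
      by (rule mult[OF f mult_closed[OF h l] g subset_refl fin[OF f] supp_sub, symmetric])
    finally show "(f \<otimes>\<^bsub>group_ring k G\<^esub> h \<otimes>\<^bsub>group_ring k G\<^esub> l) g =
        (f \<otimes>\<^bsub>group_ring k G\<^esub> (h \<otimes>\<^bsub>group_ring k G\<^esub> l)) g" .
  qed (intro mult_closed f h l)+
  have one: "\<one>\<^bsub>group_ring k G\<^esub> \<in> carrier (group_ring k G)"
    by (rule carrierI[of _ "{\<one>\<^bsub>G\<^esub>}"]) (auto simp: group_ring_def supp_def split: if_splits)
  have add: "(f \<oplus>\<^bsub>group_ring k G\<^esub> h) g = f g \<oplus>\<^bsub>k\<^esub> h g" if "g \<in> carrier G" for f h g
    using that by (simp add: group_ring_def)
  have add_closed: "f \<oplus>\<^bsub>group_ring k G\<^esub> h \<in> carrier (group_ring k G)"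
    if f: "f \<in> carrier (group_ring k G)" and h: "h \<in> carrier (group_ring k G)" for f h
  proof (rule carrierI)
    show "f \<oplus>\<^bsub>group_ring k G\<^esub> h \<in> carrier G \<rightarrow>\<^sub>E carrier k"
      using f h by (auto simp: group_ring_def)
    show "supp (f \<oplus>\<^bsub>group_ring k G\<^esub> h) \<subseteq> supp f \<union> supp h"
      by (auto simp: supp_def add)
    show "finite (supp f \<union> supp h)"
      using f h by (simp add: fin)
  qed
  have zero: "\<zero>\<^bsub>group_ring k G\<^esub> \<in> carrier (group_ring k G)"
    by (rule carrierI[of _ "{}"]) (auto simp: group_ring_def supp_def)
  have zero_ap: "\<zero>\<^bsub>group_ring k G\<^esub> g = \<zero>\<^bsub>k\<^esub>" if "g \<in> carrier G" for g
    using that by (simp add: group_ring_def)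
  have one_ap: "\<one>\<^bsub>group_ring k G\<^esub> g = (if g = \<one>\<^bsub>G\<^esub> then \<one>\<^bsub>k\<^esub> else \<zero>\<^bsub>k\<^esub>)" if "g \<in> carrier G" for g
    using that by (simp add: group_ring_def)
  show ?thesis
  proof (rule ringI)
    show "abelian_group (group_ring k G)"
    proof (rule abelian_groupI)
      fix f assume f: "f \<in> carrier (group_ring k G)"
      define f' where "f' = (\<lambda>g\<in>carrier G. \<ominus>\<^bsub>k\<^esub> f g)"
      have f': "f' \<in> carrier (group_ring k G)"
        by (rule carrierI[of _ "supp f"]) (auto simp: f'_def supp_def closed f fin[OF f, unfolded supp_def])
      have "f' \<oplus>\<^bsub>group_ring k G\<^esub> f = \<zero>\<^bsub>group_ring k G\<^esub>"
        by (rule ext) (auto simp: add_closed f f' zero add zero_ap closed k.l_neg, simp add: f'_def closed f k.l_neg)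
      then show "\<exists>f' \<in> carrier (group_ring k G). f' \<oplus>\<^bsub>group_ring k G\<^esub> f = \<zero>\<^bsub>group_ring k G\<^esub>"
        using f' by blast
    qed (auto intro!: ext add_closed zero simp: add zero_ap k.a_assoc k.a_comm k.a_lcomm k.l_zero closed)
    show "monoid (group_ring k G)"
    proof (rule monoidI)
      fix f assume f: "f \<in> carrier (group_ring k G)"
      show "\<one>\<^bsub>group_ring k G\<^esub> \<otimes>\<^bsub>group_ring k G\<^esub> f = f"
      proof (rule ext)
        fix g assume g: "g \<in> carrier G"
        have "(\<one>\<^bsub>group_ring k G\<^esub> \<otimes>\<^bsub>group_ring k G\<^esub> f) g = (\<Oplus>\<^bsub>k\<^esub>a\<in>{\<one>\<^bsub>G\<^esub>}.
            \<one>\<^bsub>group_ring k G\<^esub> a \<otimes>\<^bsub>k\<^esub> f (inv\<^bsub>G\<^esub> a \<otimes>\<^bsub>G\<^esub> g))"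
          by (rule mult[OF one f g]) (auto simp: supp_def one_ap split: if_splits)
        then show "(\<one>\<^bsub>group_ring k G\<^esub> \<otimes>\<^bsub>group_ring k G\<^esub> f) g = f g"
          using g by (simp add: one_ap closed f)
      qed (intro mult_closed one f)+
      show "f \<otimes>\<^bsub>group_ring k G\<^esub> \<one>\<^bsub>group_ring k G\<^esub> = f"
      proof (rule ext)
        fix g assume g: "g \<in> carrier G"
        have "(f \<otimes>\<^bsub>group_ring k G\<^esub> \<one>\<^bsub>group_ring k G\<^esub>) g = (\<Oplus>\<^bsub>k\<^esub>a\<in>insert g (supp f).
            f a \<otimes>\<^bsub>k\<^esub> \<one>\<^bsub>group_ring k G\<^esub> (inv\<^bsub>G\<^esub> a \<otimes>\<^bsub>G\<^esub> g))"
          by (rule mult[OF f one g]) (use g fin[OF f] in \<open>auto simp: supp_def\<close>)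
        also have "\<dots> = (\<Oplus>\<^bsub>k\<^esub>a\<in>insert g (supp f). if g = a then f a else \<zero>\<^bsub>k\<^esub>)"
        proof (rule k.finsum_cong')
          fix a assume "a \<in> insert g (supp f)"
          then have a: "a \<in> carrier G" using g by (auto simp: supp_def)
          have "inv\<^bsub>G\<^esub> a \<otimes>\<^bsub>G\<^esub> g = \<one>\<^bsub>G\<^esub> \<longleftrightarrow> g = a"
            using a g by (metis G.inv_closed G.inv_inv G.inv_solve_left' G.l_inv G.r_one G.one_closed)
          then show "f a \<otimes>\<^bsub>k\<^esub> \<one>\<^bsub>group_ring k G\<^esub> (inv\<^bsub>G\<^esub> a \<otimes>\<^bsub>G\<^esub> g) = (if g = a then f a else \<zero>\<^bsub>k\<^esub>)"
            using a g by (simp add: one_ap closed f)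
        qed (use g in \<open>auto simp: supp_def closed f\<close>)
        also have "\<dots> = f g"
          using g fin[OF f] by (intro k.add.finprod_singleton) (auto simp: supp_def closed f)
        finally show "(f \<otimes>\<^bsub>group_ring k G\<^esub> \<one>\<^bsub>group_ring k G\<^esub>) g = f g" .
      qed (intro mult_closed one f)+
    qed (simp_all add: mult_closed mult_assoc one)
  next
    fix f h l assume fhl: "f \<in> carrier (group_ring k G)" "h \<in> carrier (group_ring k G)"
      "l \<in> carrier (group_ring k G)"
    show "(f \<oplus>\<^bsub>group_ring k G\<^esub> h) \<otimes>\<^bsub>group_ring k G\<^esub> l =
        f \<otimes>\<^bsub>group_ring k G\<^esub> l \<oplus>\<^bsub>group_ring k G\<^esub> h \<otimes>\<^bsub>group_ring k G\<^esub> l"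
    proof (rule ext)
      fix g assume g: "g \<in> carrier G"
      define S where "S = supp f \<union> supp h"
      have S: "finite S" "S \<subseteq> carrier G" "supp f \<subseteq> S" "supp h \<subseteq> S"
        "supp (f \<oplus>\<^bsub>group_ring k G\<^esub> h) \<subseteq> S"
        using fhl by (auto simp: S_def fin) (auto simp: supp_def add)
      show "((f \<oplus>\<^bsub>group_ring k G\<^esub> h) \<otimes>\<^bsub>group_ring k G\<^esub> l) g =
          (f \<otimes>\<^bsub>group_ring k G\<^esub> l \<oplus>\<^bsub>group_ring k G\<^esub> h \<otimes>\<^bsub>group_ring k G\<^esub> l) g"
        unfolding add[OF g] mult[OF add_closed[OF fhl(1,2)] fhl(3) g S(5,1,2)]
          mult[OF fhl(1,3) g S(3,1,2)] mult[OF fhl(2,3) g S(4,1,2)]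
        using S g by (intro trans[OF k.finsum_cong' k.finsum_addf])
          (auto simp: add k.l_distr closed fhl subset_iff)
    qed (intro mult_closed add_closed fhl)+
    show "l \<otimes>\<^bsub>group_ring k G\<^esub> (f \<oplus>\<^bsub>group_ring k G\<^esub> h) =
        l \<otimes>\<^bsub>group_ring k G\<^esub> f \<oplus>\<^bsub>group_ring k G\<^esub> l \<otimes>\<^bsub>group_ring k G\<^esub> h"
    proof (rule ext)
      fix g assume g: "g \<in> carrier G"
      note S = subset_refl fin[OF fhl(3)] supp_sub
      show "(l \<otimes>\<^bsub>group_ring k G\<^esub> (f \<oplus>\<^bsub>group_ring k G\<^esub> h)) g =
          (l \<otimes>\<^bsub>group_ring k G\<^esub> f \<oplus>\<^bsub>group_ring k G\<^esub> l \<otimes>\<^bsub>group_ring k G\<^esub> h) g"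
        unfolding add[OF g] mult[OF fhl(3) add_closed[OF fhl(1,2)] g S]
          mult[OF fhl(3,1) g S] mult[OF fhl(3,2) g S]
        using supp_sub[of l] g by (intro trans[OF k.finsum_cong' k.finsum_addf])
          (auto simp: add k.r_distr closed fhl subset_iff)
    qed (intro mult_closed add_closed fhl)+
  qed
qed


section \<open>Modules over noncommutative rings\<close>

locale left_module = R?: ring R + M?: abelian_group M
    for R :: "('r, 'x) ring_scheme" (structure) and M :: "('r, 'm, 'z) module_scheme" (structure) +
  assumes smult_closed:
      "\<lbrakk>r \<in> carrier R; m \<in> carrier M\<rbrakk> \<Longrightarrow> r \<odot>\<^bsub>M\<^esub> m \<in> carrier M"
    and smult_l_distr:
      "\<lbrakk>r \<in> carrier R; s \<in> carrier R; m \<in> carrier M\<rbrakk> \<Longrightarrow>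
        (r \<oplus>\<^bsub>R\<^esub> s) \<odot>\<^bsub>M\<^esub> m = r \<odot>\<^bsub>M\<^esub> m \<oplus>\<^bsub>M\<^esub> s \<odot>\<^bsub>M\<^esub> m"
    and smult_r_distr:
      "\<lbrakk>r \<in> carrier R; m \<in> carrier M; n \<in> carrier M\<rbrakk> \<Longrightarrow>
        r \<odot>\<^bsub>M\<^esub> (m \<oplus>\<^bsub>M\<^esub> n) = r \<odot>\<^bsub>M\<^esub> m \<oplus>\<^bsub>M\<^esub> r \<odot>\<^bsub>M\<^esub> n"
    and smult_assoc:
      "\<lbrakk>r \<in> carrier R; s \<in> carrier R; m \<in> carrier M\<rbrakk> \<Longrightarrow>
        (r \<otimes>\<^bsub>R\<^esub> s) \<odot>\<^bsub>M\<^esub> m = r \<odot>\<^bsub>M\<^esub> (s \<odot>\<^bsub>M\<^esub> m)"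
    and smult_one:
      "m \<in> carrier M \<Longrightarrow> \<one>\<^bsub>R\<^esub> \<odot>\<^bsub>M\<^esub> m = m"

text \<open>As for \<^typ>\<open>('a, 'b) module\<close>, the multiplication and unit fields inherited from the ring
  record play no role.\<close>

record ('a, 'b) rmodule = "'b ring" +
  rsmult :: "['b, 'a] \<Rightarrow> 'b" (infixl \<open>\<bullet>\<index>\<close> 70)

locale right_module = R?: ring R + N?: abelian_group N
    for R :: "('r, 'x) ring_scheme" (structure) and N :: "('r, 'n, 'z) rmodule_scheme" (structure) +
  assumes rsmult_closed:
      "\<lbrakk>n \<in> carrier N; r \<in> carrier R\<rbrakk> \<Longrightarrow> n \<bullet>\<^bsub>N\<^esub> r \<in> carrier N"
    and rsmult_l_distr:
      "\<lbrakk>n \<in> carrier N; n' \<in> carrier N; r \<in> carrier R\<rbrakk> \<Longrightarrow>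
        (n \<oplus>\<^bsub>N\<^esub> n') \<bullet>\<^bsub>N\<^esub> r = n \<bullet>\<^bsub>N\<^esub> r \<oplus>\<^bsub>N\<^esub> n' \<bullet>\<^bsub>N\<^esub> r"
    and rsmult_r_distr:
      "\<lbrakk>n \<in> carrier N; r \<in> carrier R; s \<in> carrier R\<rbrakk> \<Longrightarrow>
        n \<bullet>\<^bsub>N\<^esub> (r \<oplus>\<^bsub>R\<^esub> s) = n \<bullet>\<^bsub>N\<^esub> r \<oplus>\<^bsub>N\<^esub> n \<bullet>\<^bsub>N\<^esub> s"
    and rsmult_assoc:
      "\<lbrakk>n \<in> carrier N; r \<in> carrier R; s \<in> carrier R\<rbrakk> \<Longrightarrow>
        n \<bullet>\<^bsub>N\<^esub> (r \<otimes>\<^bsub>R\<^esub> s) = (n \<bullet>\<^bsub>N\<^esub> r) \<bullet>\<^bsub>N\<^esub> s"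
    and rsmult_one:
      "n \<in> carrier N \<Longrightarrow> n \<bullet>\<^bsub>N\<^esub> \<one>\<^bsub>R\<^esub> = n"

definition right_module_hom ::
    "('r, 'x) ring_scheme \<Rightarrow> ('r, 'n, 'y) rmodule_scheme \<Rightarrow> ('r, 'n1, 'z) rmodule_scheme \<Rightarrow> ('n \<Rightarrow> 'n1) set"
  where "right_module_hom R N N1 =
    {f \<in> hom (add_monoid N) (add_monoid N1).
      \<forall>n \<in> carrier N. \<forall>r \<in> carrier R. f (n \<bullet>\<^bsub>N\<^esub> r) = f n \<bullet>\<^bsub>N1\<^esub> r}"

definition restrict_scalars :: "('r \<Rightarrow> 'q) \<Rightarrow> ('q, 'x) ring_scheme \<Rightarrow> ('r, 'q) module"
  where "restrict_scalars \<phi> Q =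
    \<lparr>carrier = carrier Q, monoid.mult = (\<otimes>\<^bsub>Q\<^esub>), one = \<one>\<^bsub>Q\<^esub>, ring.zero = \<zero>\<^bsub>Q\<^esub>, ring.add = (\<oplus>\<^bsub>Q\<^esub>),
     smult = (\<lambda>r q. \<phi> r \<otimes>\<^bsub>Q\<^esub> q)\<rparr>"

lemma left_module_restrict_scalars:
  assumes "ring R" "ring Q" "\<phi> \<in> ring_hom R Q"
  shows "left_module R (restrict_scalars \<phi> Q)"
proof -
  interpret R: ring R by fact
  interpret Q: ring Q by fact
  interpret M: abelian_group "restrict_scalars \<phi> Q"
    by (rule abelian_groupI)
      (auto simp: restrict_scalars_def Q.a_assoc Q.a_comm Q.a_lcomm intro: Q.add.l_inv_ex)
  show ?thesis
    using assms(3)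
    by unfold_locales
      (auto simp: restrict_scalars_def ring_hom_closed[OF assms(3)] ring_hom_add[OF assms(3)]
        ring_hom_mult[OF assms(3)] ring_hom_one[OF assms(3)] Q.l_distr Q.r_distr Q.m_assoc)
qed


section \<open>Tensor products and flatness\<close>

text \<open>The tensor product of a right module \<open>N\<close> and a left module \<open>M\<close> over \<open>R\<close> is the free abelian
  group on \<open>N \<times> M\<close> modulo the subgroup generated by the usual relations.\<close>

abbreviation tensor_free ::
    "('r, 'n, 'y) rmodule_scheme \<Rightarrow> ('r, 'm, 'z) module_scheme \<Rightarrow> ('n \<times> 'm \<Rightarrow>\<^sub>0 int) monoid"
  where "tensor_free N M \<equiv> free_Abelian_group (carrier N \<times> carrier M)"

definition tensor_relations ::
    "('r, 'x) ring_scheme \<Rightarrow> ('r, 'n, 'y) rmodule_scheme \<Rightarrow> ('r, 'm, 'z) module_scheme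
      \<Rightarrow> ('n \<times> 'm \<Rightarrow>\<^sub>0 int) set"
  where "tensor_relations R N M =
      {frag_of (n \<oplus>\<^bsub>N\<^esub> n', m) - frag_of (n, m) - frag_of (n', m) | n n' m.
         n \<in> carrier N \<and> n' \<in> carrier N \<and> m \<in> carrier M}
    \<union> {frag_of (n, m \<oplus>\<^bsub>M\<^esub> m') - frag_of (n, m) - frag_of (n, m') | n m m'.
         n \<in> carrier N \<and> m \<in> carrier M \<and> m' \<in> carrier M}
    \<union> {frag_of (n \<bullet>\<^bsub>N\<^esub> r, m) - frag_of (n, r \<odot>\<^bsub>M\<^esub> m) | n r m.
         n \<in> carrier N \<and> r \<in> carrier R \<and> m \<in> carrier M}"

definition tensor_kernel ::
    "('r, 'x) ring_scheme \<Rightarrow> ('r, 'n, 'y) rmodule_scheme \<Rightarrow> ('r, 'm, 'z) module_scheme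
      \<Rightarrow> ('n \<times> 'm \<Rightarrow>\<^sub>0 int) set"
  where "tensor_kernel R N M = generate (tensor_free N M) (tensor_relations R N M)"

definition tensor_product ::
    "('r, 'x) ring_scheme \<Rightarrow> ('r, 'n, 'y) rmodule_scheme \<Rightarrow> ('r, 'm, 'z) module_scheme
      \<Rightarrow> ('n \<times> 'm \<Rightarrow>\<^sub>0 int) set monoid"
  where "tensor_product R N M = tensor_free N M Mod tensor_kernel R N M"

text \<open>The map \<open>f \<otimes> id\<close> on tensor products, induced by \<open>(n, m) \<mapsto> (f n, m)\<close>.
  All representatives \<open>c\<close> of a coset have their images in one coset, so \<^const>\<open>the_elem\<close> picks it out.\<close>

definition tensor_map ::
    "('r, 'x) ring_scheme \<Rightarrow> ('r, 'n1, 'y) rmodule_scheme \<Rightarrow> ('r, 'm, 'z) module_scheme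
      \<Rightarrow> ('n \<Rightarrow> 'n1) \<Rightarrow> ('n \<times> 'm \<Rightarrow>\<^sub>0 int) set \<Rightarrow> ('n1 \<times> 'm \<Rightarrow>\<^sub>0 int) set"
  where "tensor_map R N1 M f C =
    the_elem ((\<lambda>c. tensor_kernel R N1 M #>\<^bsub>tensor_free N1 M\<^esub>
                     frag_extend (\<lambda>(n, m). frag_of (f n, m)) c) ` C)"

lemma tensor_map_coset:
  fixes M :: "('r, 'm, 'z) module_scheme"
  assumes f: "f \<in> right_module_hom R N N1" and N: "right_module R N" and N1: "right_module R N1"
    and M: "left_module R M" and c: "c \<in> carrier (tensor_free N M)"
  shows "tensor_map R N1 M f
    (tensor_kernel R N M #>\<^bsub>tensor_free N M\<^esub> c) =
    tensor_kernel R N1 M #>\<^bsub>tensor_free N1 M\<^esub> frag_extend (\<lambda>(n, m). frag_of (f n, m)) c"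
proof -
  interpret N: right_module R N by fact
  interpret N1: right_module R N1 by fact
  interpret M: left_module R M by fact
  interpret F: group "tensor_free N M" by simp
  interpret F1: group "tensor_free N1 M" by simp
  define E where "E = frag_extend (\<lambda>(n, m :: 'm). frag_of (f n, m))"
  have f_closed: "f n \<in> carrier N1" if "n \<in> carrier N" for n
    using f that by (auto simp: right_module_hom_def hom_def)
  have f_add: "f (n \<oplus>\<^bsub>N\<^esub> n') = f n \<oplus>\<^bsub>N1\<^esub> f n'" if "n \<in> carrier N" "n' \<in> carrier N" for n n'
    using f that by (auto simp: right_module_hom_def hom_def)
  have f_smult: "f (n \<bullet>\<^bsub>N\<^esub> r) = f n \<bullet>\<^bsub>N1\<^esub> r" if "n \<in> carrier N" "r \<in> carrier R" for n r
    using f that by (auto simp: right_module_hom_def)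
  have E: "E \<in> hom (tensor_free N M) (tensor_free N1 M)"
  proof (rule homI)
    fix c assume "c \<in> carrier (tensor_free N M)"
    then have "Poly_Mapping.keys c \<subseteq> carrier N \<times> carrier M"
      by (simp add: free_Abelian_group_def)
    then have "(\<Union>p\<in>Poly_Mapping.keys c. Poly_Mapping.keys (case p of (n, m) \<Rightarrow> frag_of (f n, m))) \<subseteq> carrier N1 \<times> carrier M"
      using f_closed by (auto split: prod.splits)
    then have "Poly_Mapping.keys (E c) \<subseteq> carrier N1 \<times> carrier M"
      unfolding E_def using keys_frag_extend by (rule order.trans[rotated])
    then show "E c \<in> carrier (tensor_free N1 M)"
      by (simp add: free_Abelian_group_def)
  qed (simp add: E_def frag_extend_add)
  interpret E: group_hom "tensor_free N M" "tensor_free N1 M" E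
    by unfold_locales (rule E)
  have rel: "tensor_relations R N M \<subseteq> carrier (tensor_free N M)"
    and rel1: "tensor_relations R N1 M \<subseteq> carrier (tensor_free N1 M)"
    unfolding tensor_relations_def free_Abelian_group_def
    by (auto dest!: subsetD[OF keys_diff] simp: N.rsmult_closed N1.rsmult_closed M.smult_closed)
  have "E ` tensor_relations R N M \<subseteq> tensor_relations R N1 M"
  proof -
    have *: "E (frag_of (n, m)) = frag_of (f n, m)" "E (a - b) = E a - E b" for n m a b
      by (simp_all add: E_def frag_extend_diff)
    show ?thesis
      unfolding tensor_relations_def
      by (auto simp: * f_add f_smult) (blast intro: f_closed)+
  qed
  then have EK: "E k \<in> tensor_kernel R N1 M" if "k \<in> tensor_kernel R N M" for k
    using that E.generate_img[OF rel] F1.mono_generate unfolding tensor_kernel_def by blast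
  have K1: "subgroup (tensor_kernel R N1 M) (tensor_free N1 M)"
    unfolding tensor_kernel_def by (rule F1.generate_is_subgroup[OF rel1])
  have K: "subgroup (tensor_kernel R N M) (tensor_free N M)"
    unfolding tensor_kernel_def by (rule F.generate_is_subgroup[OF rel])
  have "tensor_kernel R N1 M #>\<^bsub>tensor_free N1 M\<^esub> E d =
      tensor_kernel R N1 M #>\<^bsub>tensor_free N1 M\<^esub> E c"
    if d: "d \<in> tensor_kernel R N M #>\<^bsub>tensor_free N M\<^esub> c" for d
  proof -
    obtain a where "a \<in> tensor_kernel R N M" "d = a + c"
      using d by (auto simp: r_coset_def)
    then have "E d \<in> tensor_kernel R N1 M #>\<^bsub>tensor_free N1 M\<^esub> E c"
      using EK by (auto simp: r_coset_def E_def frag_extend_add)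
    then show ?thesis
      using F1.repr_independence[OF _ E.hom_closed[OF c] K1] by simp
  qed
  moreover have "c \<in> tensor_kernel R N M #>\<^bsub>tensor_free N M\<^esub> c"
    by (rule F.rcos_self[OF c K])
  ultimately have "(\<lambda>d. tensor_kernel R N1 M #>\<^bsub>tensor_free N1 M\<^esub> E d) `
      (tensor_kernel R N M #>\<^bsub>tensor_free N M\<^esub> c) =
      {tensor_kernel R N1 M #>\<^bsub>tensor_free N1 M\<^esub> E c}"
    by blast
  then show ?thesis
    by (simp add: tensor_map_def flip: E_def)
qed

text \<open>A left module \<open>M\<close> is flat if tensoring with it preserves injectivity of homomorphisms of right
  modules. A definition cannot range over all types, so the right modules have their elements in a
  given type \<open>'n\<close>. A larger \<open>'n\<close> gives a stronger condition, and taking \<open>'n\<close> to be the element type of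
  \<open>R\<close> already gives flatness: then all right ideals of \<open>R\<close> and \<open>R\<close> itself are covered, and by
  Baer's criterion injectivity of all \<open>I \<otimes> M \<rightarrow> R \<otimes> M\<close> suffices.\<close>

definition flat_module ::
    "'n itself \<Rightarrow> ('r, 'x) ring_scheme \<Rightarrow> ('r, 'm, 'z) module_scheme \<Rightarrow> bool"
  where "flat_module _ R M \<longleftrightarrow>
    (\<forall>(N :: ('r, 'n) rmodule) (N1 :: ('r, 'n) rmodule) f.
      right_module R N \<and> right_module R N1 \<and> f \<in> right_module_hom R N N1 \<and> inj_on f (carrier N)
      \<longrightarrow> inj_on (tensor_map R N1 M f) (carrier (tensor_product R N M)))"

end

theory Submission
  imports Defs
begin

text \<open>
  Write \<open>a\<close> for a nontrivial element of the factor \<open>A\<^sub>0\<close> of the base group \<open>B\<close>. The obstruction to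
  flatness is that the right ideals \<open>(1 - x)kG\<close> and \<open>(1 - a)kG\<close> have too small an intersection.

  Tensoring with a flat module preserves intersections, so a flat \<open>Q\<close> would satisfy
  \<open>(1 - x)Q \<inter> (1 - a)Q = ((1 - x)kG \<inter> (1 - a)kG)Q\<close>. Since \<open>1 - x\<close> is a unit of \<open>Q\<close>, the left-hand side is
  \<open>(1 - a)Q\<close>, and \<open>1 - a\<close> would be a finite sum of products \<open>wq\<close> with \<open>w\<close> in the intersection of the two
  ideals of \<open>kG\<close> and \<open>q \<in> Q\<close> (\<open>flat_imp_mem_extended_intersection\<close>).

  This is refuted by annihilators. Let \<open>H n\<close> be the finite group generated by the \<open>A\<^sub>p\<close> with
  \<open>0 < \<bar>p\<bar> \<le> n\<close>, and let \<open>e\<close> be the sum of its elements in \<open>kG\<close>. Multiplication by \<open>e\<close> kills \<open>1 - b\<close> for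
  every \<open>b \<in> H n\<close>, in particular for the conjugates of \<open>a\<close> by \<open>x\<^sup>p\<close> with \<open>0 < \<bar>p\<bar> \<le> n\<close>. A telescoping
  argument shows that \<open>e\<close> then kills any given \<open>w \<in> (1 - x)kG \<inter> (1 - a)kG\<close> once \<open>n\<close> is large
  (\<open>subset_sum_annihilates_intersection\<close>). But \<open>e(1 - a)\<close> is never zero, because \<open>a\<close> itself is not in
  \<open>H n\<close> (\<open>subset_sum_mult_one_minus_nonzero\<close>), and it stays nonzero in \<open>Q\<close>.
\<close>

section \<open>Flat modules and the tensor relation\<close>

lemma tensor_relations_closed:
  assumes "right_module R N" "left_module R M"
  shows "tensor_relations R N M \<subseteq> carrier (tensor_free N M)"
proof -
  interpret N: right_module R N by fact
  interpret M: left_module R M by fact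
  show ?thesis
    unfolding tensor_relations_def free_Abelian_group_def
    by (auto dest!: subsetD[OF keys_diff] simp: N.rsmult_closed M.smult_closed)
qed

lemma tensor_kernel_subgroup:
  assumes "right_module R N" "left_module R M"
  shows "subgroup (tensor_kernel R N M) (tensor_free N M)"
  unfolding tensor_kernel_def
  by (rule group.generate_is_subgroup) (simp_all add: tensor_relations_closed[OF assms])

text \<open>Flatness on representatives: an element of the free group lies in the tensor kernel as soon as
  its image under an injective homomorphism does. This is the only way in which flatness is used.\<close>

lemma flat_module_imp_mem_tensor_kernel:
  fixes N N1 :: "('r, 'n) rmodule"
  assumes flat: "flat_module TYPE('n) R M" and M: "left_module R M"
    and N: "right_module R N" and N1: "right_module R N1"
    and f: "f \<in> right_module_hom R N N1" "inj_on f (carrier N)"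
    and t: "t \<in> carrier (tensor_free N M)"
    and img: "frag_extend (\<lambda>(n, m). frag_of (f n, m)) t \<in> tensor_kernel R N1 M"
  shows "t \<in> tensor_kernel R N M"
proof -
  interpret F: group "tensor_free N M" by simp
  interpret F1: group "tensor_free N1 M" by simp
  interpret K1: subgroup "tensor_kernel R N1 M" "tensor_free N1 M"
    by (rule tensor_kernel_subgroup[OF N1 M])
  have K: "subgroup (tensor_kernel R N M) (tensor_free N M)"
    by (rule tensor_kernel_subgroup[OF N M])
  have inj: "inj_on (tensor_map R N1 M f) (carrier (tensor_product R N M))"
    using flat N N1 f by (simp add: flat_module_def)
  have coset: "tensor_kernel R N M #>\<^bsub>tensor_free N M\<^esub> c \<in> carrier (tensor_product R N M)"
    if "c \<in> carrier (tensor_free N M)" for c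
    using that by (auto simp: tensor_product_def FactGroup_def RCOSETS_def)
  have zero: "0 \<in> carrier (tensor_free N M)" "0 \<in> tensor_kernel R N1 M"
    using F.one_closed K1.one_closed by simp_all
  have "tensor_map R N1 M f (tensor_kernel R N M #>\<^bsub>tensor_free N M\<^esub> t) =
      tensor_map R N1 M f (tensor_kernel R N M #>\<^bsub>tensor_free N M\<^esub> 0)"
    unfolding tensor_map_coset[OF f(1) N N1 M t] tensor_map_coset[OF f(1) N N1 M zero(1)]
    by (simp only: K1.rcos_const[OF F1.is_group img] frag_extend_0
        K1.rcos_const[OF F1.is_group zero(2)])
  then have "tensor_kernel R N M #>\<^bsub>tensor_free N M\<^esub> t =
      tensor_kernel R N M #>\<^bsub>tensor_free N M\<^esub> 0"
    by (rule inj_onD[OF inj _ coset[OF t] coset[OF zero(1)]])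
  also have "\<dots> = tensor_kernel R N M"
    using F.coset_join2[OF zero(1) K] subgroup.one_closed[OF K] by simp
  finally show ?thesis
    using F.coset_join1 t K by blast
qed

section \<open>Right ideals\<close>

locale right_ideal = R?: ring R + I?: additive_subgroup I R
  for I and R :: "('r, 'x) ring_scheme" (structure) +
  assumes I_r_mult: "\<lbrakk>i \<in> I; r \<in> carrier R\<rbrakk> \<Longrightarrow> i \<otimes>\<^bsub>R\<^esub> r \<in> I"

lemma (in ring) right_ideal_principal:
  assumes s: "s \<in> carrier R"
  shows "right_ideal (s <# carrier R) R" "s \<in> s <# carrier R"
proof -
  have mem: "i \<in> s <# carrier R \<longleftrightarrow> (\<exists>u \<in> carrier R. i = s \<otimes> u)" for i
    by (simp add: l_coset_def)
  have "subgroup (s <# carrier R) (add_monoid R)"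
  proof (rule add.subgroupI)
    show "s <# carrier R \<subseteq> carrier R"
      using s by (auto simp: mem)
    show "s <# carrier R \<noteq> {}"
      unfolding l_coset_def by blast
  next
    fix i assume "i \<in> s <# carrier R"
    then obtain u where u: "u \<in> carrier R" "i = s \<otimes> u"
      by (auto simp: mem)
    have "\<ominus> i = s \<otimes> (\<ominus> u)" using u s by (simp add: r_minus)
    then show "\<ominus> i \<in> s <# carrier R" using u(1) a_inv_closed mem by blast
    fix j assume "j \<in> s <# carrier R"
    then obtain v where v: "v \<in> carrier R" "j = s \<otimes> v"
      by (auto simp: mem)
    have "i \<oplus> j = s \<otimes> (u \<oplus> v)" using u v s by (simp add: r_distr)
    then show "i \<oplus> j \<in> s <# carrier R" using u(1) v(1) a_closed mem by blast
  qed
  then interpret additive_subgroup "s <# carrier R" R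
    by (rule additive_subgroup.intro)
  show "right_ideal (s <# carrier R) R"
  proof unfold_locales
    fix i r assume "i \<in> s <# carrier R" and r: "r \<in> carrier R"
    then obtain u where u: "u \<in> carrier R" "i = s \<otimes> u"
      by (auto simp: mem)
    then have "i \<otimes> r = s \<otimes> (u \<otimes> r)" using s r by (simp add: m_assoc)
    then show "i \<otimes> r \<in> s <# carrier R" using u(1) r m_closed mem by blast
  qed
  have "s = s \<otimes> \<one>" using s by simp
  then show "s \<in> s <# carrier R"
    using mem one_closed by blast
qed

lemma (in ring) right_ideal_carrier: "right_ideal (carrier R) R"
  by unfold_locales auto

lemma (in ring) right_ideal_sum:
  assumes "right_ideal S R" "right_ideal T R"
  shows "right_ideal (S <+>\<^bsub>R\<^esub> T) R"
proof -
  interpret S: right_ideal S R by fact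
  interpret T: right_ideal T R by fact
  interpret additive_subgroup "S <+>\<^bsub>R\<^esub> T" R
    by (rule add_additive_subgroups) (fact S.additive_subgroup_axioms T.additive_subgroup_axioms)+
  show ?thesis
  proof unfold_locales
    fix i r assume r: "r \<in> carrier R" and "i \<in> S <+>\<^bsub>R\<^esub> T"
    then obtain w w' where w: "w \<in> S" "w' \<in> T" "i = w \<oplus> w'"
      by (auto simp: set_add_def set_mult_def)
    then have "i \<otimes> r = w \<otimes> r \<oplus> w' \<otimes> r"
      using r by (simp add: l_distr)
    then show "i \<otimes> r \<in> S <+>\<^bsub>R\<^esub> T"
      using S.I_r_mult[OF w(1) r] T.I_r_mult[OF w(2) r]
      by (simp add: set_add_def set_mult_def) blast
  qed
qed

definition right_ideal_module :: "('r, 'x) ring_scheme \<Rightarrow> 'r set \<Rightarrow> ('r, 'r) rmodule"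
  where "right_ideal_module R I =
    \<lparr>carrier = I, monoid.mult = (\<otimes>\<^bsub>R\<^esub>), one = \<one>\<^bsub>R\<^esub>, ring.zero = \<zero>\<^bsub>R\<^esub>, ring.add = (\<oplus>\<^bsub>R\<^esub>),
     rsmult = (\<otimes>\<^bsub>R\<^esub>)\<rparr>"

lemma right_module_right_ideal:
  assumes "right_ideal I R"
  shows "right_module R (right_ideal_module R I)"
proof -
  interpret I: right_ideal I R by fact
  interpret M: abelian_group "right_ideal_module R I"
  proof (rule abelian_groupI)
    fix i assume "i \<in> carrier (right_ideal_module R I)"
    then have i: "i \<in> I" by (simp add: right_ideal_module_def)
    then have "\<ominus>\<^bsub>R\<^esub> i \<in> I" "\<ominus>\<^bsub>R\<^esub> i \<oplus>\<^bsub>R\<^esub> i = \<zero>\<^bsub>R\<^esub>"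
      using I.a_inv_closed I.l_neg by (auto simp: a_inv_def)
    then show "\<exists>j \<in> carrier (right_ideal_module R I).
        j \<oplus>\<^bsub>right_ideal_module R I\<^esub> i = \<zero>\<^bsub>right_ideal_module R I\<^esub>"
      by (auto simp: right_ideal_module_def)
  qed (auto simp: right_ideal_module_def I.a_assoc intro: I.R.add.m_comm)
  show ?thesis
    by unfold_locales
      (auto simp: right_ideal_module_def I.I_r_mult I.l_distr I.r_distr I.m_assoc)
qed

section \<open>Flat extensions preserve intersections of right ideals\<close>

text \<open>For a flat extension \<open>Q\<close> and right ideals \<open>S\<close>, \<open>T\<close> of \<open>R\<close> one has \<open>SQ \<inter> TQ = (S \<inter> T)Q\<close>. If \<open>S\<close>
  contains an element that becomes a unit in \<open>Q\<close>, then \<open>SQ = Q\<close>, so every \<open>r \<in> T\<close> lies in \<open>(S \<inter> T)Q\<close>.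
  This is a weak form of the Ore condition.

  Concretely, let \<open>q = s\<inverse>r\<close>. The element \<open>s \<otimes> q - r \<otimes> 1\<close> of \<open>(S + T) \<otimes> Q\<close> vanishes in \<open>R \<otimes> Q\<close>, where it
  becomes \<open>1 \<otimes> sq - 1 \<otimes> r\<close>, so by flatness it is zero. On the other hand, since
  \<open>(S + T)/S\<close> is isomorphic to \<open>T/(S \<inter> T)\<close>, sending \<open>(w + w') \<otimes> c\<close> to \<open>w'c\<close> for \<open>w \<in> S\<close> and \<open>w' \<in> T\<close> is
  a well-defined homomorphism from \<open>(S + T) \<otimes> Q\<close> to \<open>Q/(S \<inter> T)Q\<close>. It sends this element to the
  class of \<open>-r\<close>.\<close>

lemma flat_imp_mem_extended_intersection:
  fixes R :: "('r, 'x) ring_scheme" and Q :: "('q, 'z) ring_scheme"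
  assumes "ring Q" and \<phi>: "\<phi> \<in> ring_hom R Q"
    and flat: "flat_module TYPE('r) R (restrict_scalars \<phi> Q)"
    and S: "right_ideal S R" and T: "right_ideal T R"
    and s: "s \<in> S" and r: "r \<in> T" and unit: "\<phi> s \<in> Units Q"
  shows "\<phi> r \<in> generate (add_monoid Q) {\<phi> w \<otimes>\<^bsub>Q\<^esub> q | w q. w \<in> S \<inter> T \<and> q \<in> carrier Q}"
proof -
  interpret Q: ring Q by fact
  interpret R: ring R using S by (simp add: right_ideal_def)
  interpret S: right_ideal S R by fact
  interpret T: right_ideal T R by fact
  define M where "M = restrict_scalars \<phi> Q"
  have M: "left_module R M"
    unfolding M_def by (rule left_module_restrict_scalars) (fact R.ring_axioms, fact+)
  have M_simps: "carrier M = carrier Q" "(\<oplus>\<^bsub>M\<^esub>) = (\<oplus>\<^bsub>Q\<^esub>)" "p \<odot>\<^bsub>M\<^esub> q = \<phi> p \<otimes>\<^bsub>Q\<^esub> q" for p q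
    by (simp_all add: M_def restrict_scalars_def)
  interpret phi: ring_hom_ring R Q \<phi>
    by (rule ring_hom_ringI2) (fact R.ring_axioms, fact+)

  define D where "D = {\<phi> w \<otimes>\<^bsub>Q\<^esub> q | w q. w \<in> S \<inter> T \<and> q \<in> carrier Q}"
  define K where "K = generate (add_monoid Q) D"
  have D: "D \<subseteq> carrier Q" by (auto simp: D_def)
  have K_sub: "subgroup K (add_monoid Q)"
    unfolding K_def by (rule Q.add.generate_is_subgroup) (simp add: D)
  then interpret K: additive_subgroup K Q
    by (rule additive_subgroup.intro)
  have K_D: "\<phi> w \<otimes>\<^bsub>Q\<^esub> q \<in> K" if "w \<in> S" "w \<in> T" "q \<in> carrier Q" for w q
    using that unfolding K_def D_def by (intro generate.incl) auto

  have K_minus: "a \<ominus>\<^bsub>Q\<^esub> b \<in> K" if "a \<in> K" "b \<in> K" for a b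
    using that by (simp add: Q.minus_eq)

  define I where "I = S <+>\<^bsub>R\<^esub> T"
  have I_mem: "i \<in> I \<longleftrightarrow> (\<exists>w \<in> S. \<exists>w' \<in> T. i = w \<oplus>\<^bsub>R\<^esub> w')" for i
    by (simp add: I_def set_add_def set_mult_def)
  have ri: "right_ideal I R"
    unfolding I_def by (rule R.right_ideal_sum) fact+
  interpret I: right_ideal I R by (rule ri)
  \<comment> \<open>The component of \<open>i\<close> in \<open>T\<close>, a representative of its image under \<open>(S + T)/S \<cong> T/(S \<inter> T)\<close>.\<close>
  define \<rho> where "\<rho> i = (SOME w. w \<in> T \<and> i \<ominus>\<^bsub>R\<^esub> w \<in> S)" for i
  have \<rho>: "\<rho> i \<in> T \<and> i \<ominus>\<^bsub>R\<^esub> \<rho> i \<in> S" if "i \<in> I" for i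
  proof -
    obtain w w' where w: "i = w \<oplus>\<^bsub>R\<^esub> w'" "w \<in> S" "w' \<in> T"
      using \<open>i \<in> I\<close> by (auto simp: I_mem)
    then have "w' \<in> T \<and> i \<ominus>\<^bsub>R\<^esub> w' \<in> S"
      by (simp add: R.minus_eq R.a_assoc R.r_neg)
    then show ?thesis unfolding \<rho>_def by (rule someI)
  qed
  have \<rho>_carrier [simp]: "\<rho> i \<in> carrier R" if "i \<in> I" for i
    using \<rho>[OF that] by simp
  \<comment> \<open>The choice of \<open>\<rho> i\<close> does not matter modulo \<open>S \<inter> T\<close>.\<close>
  have \<rho>_unique: "\<phi> (\<rho> i \<ominus>\<^bsub>R\<^esub> w) \<otimes>\<^bsub>Q\<^esub> q \<in> K"
    if "i \<in> I" "w \<in> T" "i \<ominus>\<^bsub>R\<^esub> w \<in> S" "q \<in> carrier Q" for i w q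
  proof (rule K_D)
    show "\<rho> i \<ominus>\<^bsub>R\<^esub> w \<in> T"
      using \<rho>[OF that(1)] that(2) by (simp add: R.minus_eq)
    have "\<rho> i \<ominus>\<^bsub>R\<^esub> w = (i \<ominus>\<^bsub>R\<^esub> w) \<ominus>\<^bsub>R\<^esub> (i \<ominus>\<^bsub>R\<^esub> \<rho> i)"
      using I.a_Hcarr[OF that(1)] T.a_Hcarr[OF that(2)] \<rho>_carrier[OF that(1)]
      unfolding R.minus_eq by algebra
    then show "\<rho> i \<ominus>\<^bsub>R\<^esub> w \<in> S"
      using \<rho>[OF that(1)] that(3) by (simp add: R.minus_eq)
  qed fact
  define N where "N = right_ideal_module R I"
  define N1 where "N1 = right_ideal_module R (carrier R)"
  have N: "right_module R N"
    unfolding N_def by (rule right_module_right_ideal) fact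
  have N1: "right_module R N1"
    unfolding N1_def by (rule right_module_right_ideal) (rule R.right_ideal_carrier)
  have N_simps: "carrier N = I" "i \<oplus>\<^bsub>N\<^esub> j = i \<oplus>\<^bsub>R\<^esub> j" "i \<bullet>\<^bsub>N\<^esub> p = i \<otimes>\<^bsub>R\<^esub> p" for i j p
    by (simp_all add: N_def right_ideal_module_def)
  have N1_simps: "carrier N1 = carrier R" "i \<bullet>\<^bsub>N1\<^esub> p = i \<otimes>\<^bsub>R\<^esub> p" for i p
    by (simp_all add: N1_def right_ideal_module_def)
  define q where "q = inv\<^bsub>Q\<^esub> (\<phi> s) \<otimes>\<^bsub>Q\<^esub> \<phi> r"
  have q: "q \<in> carrier Q" "\<phi> s \<otimes>\<^bsub>Q\<^esub> q = \<phi> r"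
    using unit r s by (simp_all add: q_def Q.Units_inv_closed flip: Q.m_assoc)
  have "s = s \<oplus>\<^bsub>R\<^esub> \<zero>\<^bsub>R\<^esub>" "r = \<zero>\<^bsub>R\<^esub> \<oplus>\<^bsub>R\<^esub> r"
    using s r by simp_all
  then have sI: "s \<in> I" and rI: "r \<in> I"
    unfolding I_mem using s r S.zero_closed T.zero_closed by blast+
  define t where "t = frag_of (s, q) - frag_of (r, \<one>\<^bsub>Q\<^esub>)"
  have t: "t \<in> carrier (tensor_free N M)"
    using sI rI q unfolding t_def free_Abelian_group_def
    by (auto dest!: subsetD[OF keys_diff] simp: N_simps M_simps)
  have "t \<in> tensor_kernel R N M"
  proof (rule flat_module_imp_mem_tensor_kernel[OF _ M N N1 _ _ t])
    show "flat_module TYPE('r) R M" using flat by (simp add: M_def)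
    show "(\<lambda>i. i) \<in> right_module_hom R N N1"
      by (auto simp: right_module_hom_def hom_def N_def N1_def right_ideal_module_def)
    have tens: "frag_of (p, c) - frag_of (\<one>\<^bsub>R\<^esub>, \<phi> p \<otimes>\<^bsub>Q\<^esub> c) \<in> tensor_kernel R N1 M"
      if "p \<in> carrier R" "c \<in> carrier Q" for p c
    proof -
      have "frag_of (\<one>\<^bsub>R\<^esub> \<bullet>\<^bsub>N1\<^esub> p, c) - frag_of (\<one>\<^bsub>R\<^esub>, p \<odot>\<^bsub>M\<^esub> c) \<in> tensor_relations R N1 M"
        using that by (auto simp: tensor_relations_def N1_simps(1) M_simps(1))
      then show ?thesis
        unfolding tensor_kernel_def using that by (simp add: N1_simps M_simps generate.incl)
    qed
    interpret K1: subgroup "tensor_kernel R N1 M" "tensor_free N1 M"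
      by (rule tensor_kernel_subgroup[OF N1 M])
    have K1_diff: "a - b \<in> tensor_kernel R N1 M"
      if "a \<in> tensor_kernel R N1 M" "b \<in> tensor_kernel R N1 M" for a b
      using K1.m_closed[OF that(1) K1.m_inv_closed[OF that(2)]] K1.mem_carrier[OF that(2)] by simp
    have "(frag_of (s, q) - frag_of (\<one>\<^bsub>R\<^esub>, \<phi> r)) -
        (frag_of (r, \<one>\<^bsub>Q\<^esub>) - frag_of (\<one>\<^bsub>R\<^esub>, \<phi> r)) \<in> tensor_kernel R N1 M"
      using K1_diff[OF tens[of s q] tens[of r "\<one>\<^bsub>Q\<^esub>"]] s r q by simp
    then show "frag_extend (\<lambda>(i, c). frag_of (i, c)) t \<in> tensor_kernel R N1 M"
      by (simp add: t_def frag_extend_diff)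
  qed simp

  \<comment> \<open>A lift to free generators of the map \<open>i \<otimes> c \<mapsto> \<rho>(i)c\<close>; modulo \<open>K = (S \<inter> T)Q\<close> it respects the tensor relations.\<close>
  obtain E where E_hom: "E \<in> hom (tensor_free N M) (add_monoid Q)"
    and E_of: "\<And>p. p \<in> carrier N \<times> carrier M \<Longrightarrow> E (frag_of p) = (case p of (i, q) \<Rightarrow> \<phi> (\<rho> i) \<otimes>\<^bsub>Q\<^esub> q)"
    by (rule comm_group.free_Abelian_group_universal
        [OF Q.a_comm_group, where S = "carrier N \<times> carrier M" and f = "\<lambda>(i, q). \<phi> (\<rho> i) \<otimes>\<^bsub>Q\<^esub> q"])
      (auto simp: N_simps M_simps)
  interpret E: group_hom "tensor_free N M" "add_monoid Q" E
    by (intro group_hom.intro group_hom_axioms.intro E_hom Q.add.is_group) simp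
  have E_frag: "E (frag_of (i, c)) = \<phi> (\<rho> i) \<otimes>\<^bsub>Q\<^esub> c" if "i \<in> I" "c \<in> carrier Q" for i c
    using E_of that by (simp add: N_simps M_simps)
  have E_diff: "E (a - b) = E a \<ominus>\<^bsub>Q\<^esub> E b"
    if "a \<in> carrier (tensor_free N M)" "b \<in> carrier (tensor_free N M)" for a b
    using E.hom_mult[OF that(1) E.G.inv_closed[OF that(2)]] E.hom_inv[OF that(2)] that
    by (simp add: Q.minus_eq a_inv_def)
  have frag_closed: "frag_of (i, c) \<in> carrier (tensor_free N M)" if "i \<in> I" "c \<in> carrier Q" for i c
    using that by (simp add: N_simps M_simps)
  have free_diff: "a - b \<in> carrier (tensor_free N M)"
    if "a \<in> carrier (tensor_free N M)" "b \<in> carrier (tensor_free N M)" for a b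
    using that by (auto dest!: subsetD[OF keys_diff])
  have rel: "E ` tensor_relations R N M \<subseteq> K"
  proof -
    have "E (frag_of (i \<oplus>\<^bsub>R\<^esub> j, c) - frag_of (i, c) - frag_of (j, c)) \<in> K"
      if "i \<in> I" "j \<in> I" "c \<in> carrier Q" for i j c
    proof -
      have "E (frag_of (i \<oplus>\<^bsub>R\<^esub> j, c) - frag_of (i, c) - frag_of (j, c)) =
          \<phi> (\<rho> (i \<oplus>\<^bsub>R\<^esub> j) \<ominus>\<^bsub>R\<^esub> (\<rho> i \<oplus>\<^bsub>R\<^esub> \<rho> j)) \<otimes>\<^bsub>Q\<^esub> c"
      proof -
        have "E (frag_of (i \<oplus>\<^bsub>R\<^esub> j, c) - frag_of (i, c) - frag_of (j, c)) =
            \<phi> (\<rho> (i \<oplus>\<^bsub>R\<^esub> j)) \<otimes>\<^bsub>Q\<^esub> c \<ominus>\<^bsub>Q\<^esub> \<phi> (\<rho> i) \<otimes>\<^bsub>Q\<^esub> c \<ominus>\<^bsub>Q\<^esub> \<phi> (\<rho> j) \<otimes>\<^bsub>Q\<^esub> c"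
          using that by (simp add: E_diff free_diff E_frag frag_closed
              del: carrier_free_Abelian_group_iff frag_of_in_free_Abelian_group)
        then show ?thesis
          using that by (simp add: R.minus_eq Q.minus_eq R.minus_add Q.l_distr Q.l_minus Q.a_assoc)
      qed
      also have "\<dots> \<in> K"
      proof (rule \<rho>_unique)
        have "(i \<oplus>\<^bsub>R\<^esub> j) \<ominus>\<^bsub>R\<^esub> (\<rho> i \<oplus>\<^bsub>R\<^esub> \<rho> j) = (i \<ominus>\<^bsub>R\<^esub> \<rho> i) \<oplus>\<^bsub>R\<^esub> (j \<ominus>\<^bsub>R\<^esub> \<rho> j)"
          using I.a_Hcarr[OF that(1)] I.a_Hcarr[OF that(2)]
            \<rho>_carrier[OF that(1)] \<rho>_carrier[OF that(2)]
          unfolding R.minus_eq by algebra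
        then show "(i \<oplus>\<^bsub>R\<^esub> j) \<ominus>\<^bsub>R\<^esub> (\<rho> i \<oplus>\<^bsub>R\<^esub> \<rho> j) \<in> S"
          using that \<rho> by simp
      qed (use that \<rho> in auto)
      finally show ?thesis .
    qed
    moreover have "E (frag_of (i, c \<oplus>\<^bsub>Q\<^esub> c') - frag_of (i, c) - frag_of (i, c')) \<in> K"
      if "i \<in> I" "c \<in> carrier Q" "c' \<in> carrier Q" for i c c'
    proof -
      have "E (frag_of (i, c \<oplus>\<^bsub>Q\<^esub> c') - frag_of (i, c) - frag_of (i, c')) =
          \<phi> (\<rho> i) \<otimes>\<^bsub>Q\<^esub> (c \<oplus>\<^bsub>Q\<^esub> c') \<ominus>\<^bsub>Q\<^esub> \<phi> (\<rho> i) \<otimes>\<^bsub>Q\<^esub> c \<ominus>\<^bsub>Q\<^esub> \<phi> (\<rho> i) \<otimes>\<^bsub>Q\<^esub> c'"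
        using that by (simp add: E_diff free_diff E_frag frag_closed
            del: carrier_free_Abelian_group_iff frag_of_in_free_Abelian_group)
      also have "\<dots> = \<zero>\<^bsub>Q\<^esub>"
        using phi.hom_closed[OF \<rho>_carrier[OF that(1)]] that(2,3) unfolding Q.minus_eq by algebra
      finally show ?thesis by simp
    qed
    moreover have "E (frag_of (i \<otimes>\<^bsub>R\<^esub> p, c) - frag_of (i, \<phi> p \<otimes>\<^bsub>Q\<^esub> c)) \<in> K"
      if "i \<in> I" "p \<in> carrier R" "c \<in> carrier Q" for i p c
    proof -
      have "E (frag_of (i \<otimes>\<^bsub>R\<^esub> p, c) - frag_of (i, \<phi> p \<otimes>\<^bsub>Q\<^esub> c)) =
          \<phi> (\<rho> (i \<otimes>\<^bsub>R\<^esub> p) \<ominus>\<^bsub>R\<^esub> \<rho> i \<otimes>\<^bsub>R\<^esub> p) \<otimes>\<^bsub>Q\<^esub> c"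
        using that I.I_r_mult by (simp add: E_diff E_frag frag_closed R.minus_eq Q.minus_eq
            Q.l_distr Q.l_minus Q.m_assoc
            del: carrier_free_Abelian_group_iff frag_of_in_free_Abelian_group)
      also have "\<dots> \<in> K"
      proof (rule \<rho>_unique)
        have "i \<otimes>\<^bsub>R\<^esub> p \<ominus>\<^bsub>R\<^esub> \<rho> i \<otimes>\<^bsub>R\<^esub> p = (i \<ominus>\<^bsub>R\<^esub> \<rho> i) \<otimes>\<^bsub>R\<^esub> p"
          using that by (simp add: R.minus_eq R.l_distr R.l_minus)
        then show "i \<otimes>\<^bsub>R\<^esub> p \<ominus>\<^bsub>R\<^esub> \<rho> i \<otimes>\<^bsub>R\<^esub> p \<in> S"
          using that \<rho> S.I_r_mult by simp
      qed (use that \<rho> I.I_r_mult T.I_r_mult in auto)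
      finally show ?thesis .
    qed
    ultimately show ?thesis
      unfolding tensor_relations_def by (auto simp: N_simps M_simps)
  qed
  have "E ` tensor_kernel R N M \<subseteq> K"
    unfolding tensor_kernel_def E.generate_img[OF tensor_relations_closed[OF N M], symmetric]
    by (rule Q.add.generate_subgroup_incl[OF rel K_sub])
  then have "E t \<in> K" using \<open>t \<in> tensor_kernel R N M\<close> by blast
  also have "E t = \<phi> (\<rho> s) \<otimes>\<^bsub>Q\<^esub> q \<ominus>\<^bsub>Q\<^esub> \<phi> (\<rho> r)"
    using sI rI q by (simp add: t_def E_diff frag_closed E_frag
        del: carrier_free_Abelian_group_iff frag_of_in_free_Abelian_group)
  finally have *: "\<phi> (\<rho> s) \<otimes>\<^bsub>Q\<^esub> q \<ominus>\<^bsub>Q\<^esub> \<phi> (\<rho> r) \<in> K" .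
  \<comment> \<open>The components of \<open>s\<close> and \<open>r\<close> in \<open>T\<close> may be taken to be \<open>0\<close> and \<open>r\<close>.\<close>
  have "\<phi> (\<rho> s \<ominus>\<^bsub>R\<^esub> \<zero>\<^bsub>R\<^esub>) \<otimes>\<^bsub>Q\<^esub> q \<in> K"
    using s sI q by (intro \<rho>_unique) (auto simp: R.minus_eq)
  then have 1: "\<phi> (\<rho> s) \<otimes>\<^bsub>Q\<^esub> q \<in> K"
    using sI by (simp add: R.minus_eq)
  have "\<phi> (\<rho> r \<ominus>\<^bsub>R\<^esub> r) \<otimes>\<^bsub>Q\<^esub> \<one>\<^bsub>Q\<^esub> \<in> K"
    using r rI by (intro \<rho>_unique) (auto simp: R.minus_eq R.r_neg)
  then have 2: "\<phi> (\<rho> r) \<ominus>\<^bsub>Q\<^esub> \<phi> r \<in> K"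
    using rI r by (simp add: R.minus_eq Q.minus_eq)
  have "\<phi> r = \<phi> (\<rho> s) \<otimes>\<^bsub>Q\<^esub> q \<ominus>\<^bsub>Q\<^esub> (\<phi> (\<rho> s) \<otimes>\<^bsub>Q\<^esub> q \<ominus>\<^bsub>Q\<^esub> \<phi> (\<rho> r)) \<ominus>\<^bsub>Q\<^esub> (\<phi> (\<rho> r) \<ominus>\<^bsub>Q\<^esub> \<phi> r)"
    using K.a_Hcarr[OF 1] phi.hom_closed[OF \<rho>_carrier[OF rI]] phi.hom_closed[OF T.a_Hcarr[OF r]]
    unfolding Q.minus_eq by algebra
  then have "\<phi> r \<in> K"
    using K_minus[OF K_minus[OF 1 *] 2] by simp
  then show ?thesis
    by (simp add: K_def D_def)
qed

section \<open>Sums over finite subsets in a group ring\<close>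

locale group_algebra = k: ring k + G: group G
  for k :: "('k, 'y) ring_scheme" and G :: "('g, 'x) monoid_scheme" +
  assumes k_nontrivial: "\<one>\<^bsub>k\<^esub> \<noteq> \<zero>\<^bsub>k\<^esub>"
begin

abbreviation kG :: "('g \<Rightarrow> 'k) ring"
  where "kG \<equiv> group_ring k G"

abbreviation \<delta> :: "'g \<Rightarrow> 'g \<Rightarrow> 'k"
  where "\<delta> \<equiv> group_ring_of k G"

definition subset_sum :: "'g set \<Rightarrow> 'g \<Rightarrow> 'k"
  where "subset_sum H = (\<lambda>g\<in>carrier G. if g \<in> H then \<one>\<^bsub>k\<^esub> else \<zero>\<^bsub>k\<^esub>)"

sublocale kG: ring kG
  by (rule ring_group_ring) unfold_locales

lemma group_ring_apply_closed: "f \<in> carrier kG \<Longrightarrow> g \<in> carrier G \<Longrightarrow> f g \<in> carrier k"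
  by (auto simp: group_ring_def)

lemma group_ring_eqI:
  assumes "f \<in> carrier kG" "h \<in> carrier kG" "\<And>g. g \<in> carrier G \<Longrightarrow> f g = h g"
  shows "f = h"
  using assms by (auto simp: group_ring_def intro: PiE_ext)

lemma finite_support: "f \<in> carrier kG \<Longrightarrow> finite {g \<in> carrier G. f g \<noteq> \<zero>\<^bsub>k\<^esub>}"
  by (simp add: group_ring_def)

lemma zero_apply: "g \<in> carrier G \<Longrightarrow> \<zero>\<^bsub>kG\<^esub> g = \<zero>\<^bsub>k\<^esub>"
  by (simp add: group_ring_def)

lemma minus_apply:
  assumes "f \<in> carrier kG" "h \<in> carrier kG" "g \<in> carrier G"
  shows "(f \<ominus>\<^bsub>kG\<^esub> h) g = f g \<ominus>\<^bsub>k\<^esub> h g"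
proof -
  have "f = (f \<ominus>\<^bsub>kG\<^esub> h) \<oplus>\<^bsub>kG\<^esub> h"
    using assms by (simp add: kG.minus_eq kG.a_assoc kG.l_neg)
  then have "f g = (f \<ominus>\<^bsub>kG\<^esub> h) g \<oplus>\<^bsub>k\<^esub> h g"
    using assms(3) by (subst (asm) fun_eq_iff) (simp add: group_ring_def)
  then show ?thesis
    using group_ring_apply_closed[OF _ assms(3)] assms
    by (simp add: k.minus_eq k.a_assoc k.r_neg)
qed

lemma subset_sum_closed: "finite H \<Longrightarrow> subset_sum H \<in> carrier kG"
  by (auto simp: group_ring_def subset_sum_def)

lemma subset_sum_mult_apply:
  assumes "finite H" "H \<subseteq> carrier G" "f \<in> carrier kG" "y \<in> carrier G"
  shows "(subset_sum H \<otimes>\<^bsub>kG\<^esub> f) y = (\<Oplus>\<^bsub>k\<^esub>h\<in>H. f (inv\<^bsub>G\<^esub> h \<otimes>\<^bsub>G\<^esub> y))"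
proof -
  have "{g \<in> carrier G. subset_sum H g \<noteq> \<zero>\<^bsub>k\<^esub>} = H"
    using assms(2) k_nontrivial by (auto simp: subset_sum_def)
  then have "(subset_sum H \<otimes>\<^bsub>kG\<^esub> f) y =
      (\<Oplus>\<^bsub>k\<^esub>h\<in>H. subset_sum H h \<otimes>\<^bsub>k\<^esub> f (inv\<^bsub>G\<^esub> h \<otimes>\<^bsub>G\<^esub> y))"
    using assms(4) by (simp add: group_ring_def)
  also have "\<dots> = (\<Oplus>\<^bsub>k\<^esub>h\<in>H. f (inv\<^bsub>G\<^esub> h \<otimes>\<^bsub>G\<^esub> y))"
    using assms by (intro k.finsum_cong')
      (auto simp: subset_sum_def subset_iff group_ring_apply_closed)
  finally show ?thesis .
qed

lemma subset_sum_mult_apply_nonzeroE: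
  assumes "finite H" "H \<subseteq> carrier G" "f \<in> carrier kG" "y \<in> carrier G"
    and "(subset_sum H \<otimes>\<^bsub>kG\<^esub> f) y \<noteq> \<zero>\<^bsub>k\<^esub>"
  obtains h where "h \<in> H" "f (inv\<^bsub>G\<^esub> h \<otimes>\<^bsub>G\<^esub> y) \<noteq> \<zero>\<^bsub>k\<^esub>"
  using assms k.add.finprod_one_eqI[of H "\<lambda>h. f (inv\<^bsub>G\<^esub> h \<otimes>\<^bsub>G\<^esub> y)"]
  by (auto simp: subset_sum_mult_apply)

lemma group_ring_of_eq_subset_sum: "\<delta> g = subset_sum {g}"
  by (simp add: group_ring_of_def subset_sum_def)

lemma group_ring_of_closed [simp]: "\<delta> g \<in> carrier kG"
  by (simp add: group_ring_of_eq_subset_sum subset_sum_closed)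

lemma group_ring_of_one: "\<delta> \<one>\<^bsub>G\<^esub> = \<one>\<^bsub>kG\<^esub>"
  by (simp add: group_ring_of_def group_ring_def)

lemma group_ring_of_mult_apply:
  assumes "g \<in> carrier G" "f \<in> carrier kG" "y \<in> carrier G"
  shows "(\<delta> g \<otimes>\<^bsub>kG\<^esub> f) y = f (inv\<^bsub>G\<^esub> g \<otimes>\<^bsub>G\<^esub> y)"
  using assms by (simp add: group_ring_of_eq_subset_sum subset_sum_mult_apply group_ring_apply_closed)

lemma group_ring_of_mult:
  assumes "g \<in> carrier G" "h \<in> carrier G" "f \<in> carrier kG"
  shows "\<delta> g \<otimes>\<^bsub>kG\<^esub> (\<delta> h \<otimes>\<^bsub>kG\<^esub> f) = \<delta> (g \<otimes>\<^bsub>G\<^esub> h) \<otimes>\<^bsub>kG\<^esub> f"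
  using assms by (intro group_ring_eqI)
    (simp_all add: group_ring_of_mult_apply G.inv_mult_group G.m_assoc)

text \<open>The map \<open>h \<mapsto> hb\<close> permutes the subgroup.\<close>

lemma subset_sum_absorb:
  assumes H: "subgroup H G" "finite H" and b: "b \<in> H" and f: "f \<in> carrier kG"
  shows "subset_sum H \<otimes>\<^bsub>kG\<^esub> (\<delta> b \<otimes>\<^bsub>kG\<^esub> f) = subset_sum H \<otimes>\<^bsub>kG\<^esub> f"
proof (rule group_ring_eqI)
  interpret H: subgroup H G by fact
  fix y assume y: "y \<in> carrier G"
  have inj: "inj_on (\<lambda>h. h \<otimes>\<^bsub>G\<^esub> b) H"
    using b by (auto simp: inj_on_def)
  then have img: "(\<lambda>h. h \<otimes>\<^bsub>G\<^esub> b) ` H = H"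
    using b H(2) by (intro endo_inj_surj) auto
  have "(subset_sum H \<otimes>\<^bsub>kG\<^esub> (\<delta> b \<otimes>\<^bsub>kG\<^esub> f)) y =
      (\<Oplus>\<^bsub>k\<^esub>h\<in>H. f (inv\<^bsub>G\<^esub> (h \<otimes>\<^bsub>G\<^esub> b) \<otimes>\<^bsub>G\<^esub> y))"
    using H(2) H.subset b f y
    by (simp add: subset_sum_mult_apply)
      (intro k.finsum_cong', auto simp: group_ring_of_mult_apply G.inv_mult_group G.m_assoc
        group_ring_apply_closed)
  also have "\<dots> = (\<Oplus>\<^bsub>k\<^esub>h\<in>H. f (inv\<^bsub>G\<^esub> h \<otimes>\<^bsub>G\<^esub> y))"
    using k.finsum_reindex[OF _ inj, of "\<lambda>h. f (inv\<^bsub>G\<^esub> h \<otimes>\<^bsub>G\<^esub> y)"] f y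
    by (simp add: img Pi_def group_ring_apply_closed)
  finally show "(subset_sum H \<otimes>\<^bsub>kG\<^esub> (\<delta> b \<otimes>\<^bsub>kG\<^esub> f)) y = (subset_sum H \<otimes>\<^bsub>kG\<^esub> f) y"
    using H(2) H.subset f y by (simp add: subset_sum_mult_apply)
qed (use H f in \<open>simp_all add: subset_sum_closed\<close>)

end

section \<open>Group rings of groups of lamplighter type\<close>

text \<open>The features of a wreath product that obstruct flatness. There \<open>x\<close>
  generates a complement of the base group \<open>B\<close>, the element \<open>a\<close> is a lamp at position \<open>0\<close>, and
  \<open>H n\<close> is the group of all states of the lamps at positions \<open>p\<close> with \<open>0 < \<bar>p\<bar> \<le> n\<close>.\<close>

locale lamplighter_configuration = group_algebra k G
  for k :: "('k, 'y) ring_scheme" and G :: "('g, 'x) monoid_scheme" +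
  fixes x a :: 'g and B :: "'g set" and H :: "nat \<Rightarrow> 'g set"
  assumes x_closed: "x \<in> carrier G" and a_closed: "a \<in> carrier G"
    and B_subgroup: "subgroup B G"
    and x_power_in_B: "\<And>p::int. x [^]\<^bsub>G\<^esub> p \<in> B \<Longrightarrow> p = 0"
    and H_subgroup: "\<And>n. subgroup (H n) G"
    and H_finite: "\<And>n. finite (H n)"
    and H_sub_B: "\<And>n. H n \<subseteq> B"
    and conj_in_H: "\<And>p n. p \<noteq> 0 \<Longrightarrow> \<bar>p\<bar> \<le> int n \<Longrightarrow>
      x [^]\<^bsub>G\<^esub> p \<otimes>\<^bsub>G\<^esub> a \<otimes>\<^bsub>G\<^esub> inv\<^bsub>G\<^esub> (x [^]\<^bsub>G\<^esub> p) \<in> H n"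
    and a_notin_H: "\<And>n. a \<notin> H n"
begin

abbreviation one_minus :: "'g \<Rightarrow> 'g \<Rightarrow> 'k"
  where "one_minus g \<equiv> \<one>\<^bsub>kG\<^esub> \<ominus>\<^bsub>kG\<^esub> \<delta> g"

lemma one_minus_mult:
  assumes "f \<in> carrier kG"
  shows "one_minus g \<otimes>\<^bsub>kG\<^esub> f = f \<ominus>\<^bsub>kG\<^esub> \<delta> g \<otimes>\<^bsub>kG\<^esub> f"
  using assms by (simp add: kG.minus_eq kG.l_distr kG.l_minus)

text \<open>The coefficient at the identity is \<open>1\<close>: the term \<open>ha\<close> with \<open>h \<in> H n\<close> is never the
  identity since \<open>a\<close> is not in \<open>H n\<close>.\<close>

lemma subset_sum_mult_one_minus_nonzero: "subset_sum (H n) \<otimes>\<^bsub>kG\<^esub> one_minus a \<noteq> \<zero>\<^bsub>kG\<^esub>"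
proof -
  interpret H: subgroup "H n" G by (rule H_subgroup)
  have e: "subset_sum (H n) \<in> carrier kG"
    by (simp add: subset_sum_closed H_finite)
  have "(subset_sum (H n) \<otimes>\<^bsub>kG\<^esub> \<delta> a) \<one>\<^bsub>G\<^esub> = \<zero>\<^bsub>k\<^esub>"
  proof (rule ccontr)
    assume "(subset_sum (H n) \<otimes>\<^bsub>kG\<^esub> \<delta> a) \<one>\<^bsub>G\<^esub> \<noteq> \<zero>\<^bsub>k\<^esub>"
    then obtain h where "h \<in> H n" "\<delta> a (inv\<^bsub>G\<^esub> h \<otimes>\<^bsub>G\<^esub> \<one>\<^bsub>G\<^esub>) \<noteq> \<zero>\<^bsub>k\<^esub>"
      by (rule subset_sum_mult_apply_nonzeroE[OF H_finite H.subset group_ring_of_closed G.one_closed])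
    then have "inv\<^bsub>G\<^esub> h \<in> H n" "inv\<^bsub>G\<^esub> h = a"
      by (auto simp: group_ring_of_def split: if_splits)
    then show False using a_notin_H by simp
  qed
  moreover have "subset_sum (H n) \<otimes>\<^bsub>kG\<^esub> one_minus a =
      subset_sum (H n) \<ominus>\<^bsub>kG\<^esub> subset_sum (H n) \<otimes>\<^bsub>kG\<^esub> \<delta> a"
    using e by (simp add: kG.minus_eq kG.r_distr kG.r_minus)
  ultimately have "(subset_sum (H n) \<otimes>\<^bsub>kG\<^esub> one_minus a) \<one>\<^bsub>G\<^esub> = \<one>\<^bsub>k\<^esub>"
    using e by (simp add: minus_apply k.minus_eq) (simp add: subset_sum_def)
  then show ?thesis
    using k_nontrivial zero_apply[OF G.one_closed] by auto
qed

text \<open>An element of \<open>G\<close> lies in at most one coset \<open>Bx\<^sup>p\<close>.\<close>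

lemma finite_powers_in_B_coset:
  assumes "finite C" "C \<subseteq> carrier G"
  shows "finite {p::int. \<exists>b \<in> B. b \<otimes>\<^bsub>G\<^esub> x [^]\<^bsub>G\<^esub> p \<in> C}"
proof -
  interpret B: subgroup B G by (rule B_subgroup)
  have uniq: "p = p'" if b: "b \<in> B" "b' \<in> B" and eq: "b \<otimes>\<^bsub>G\<^esub> x [^]\<^bsub>G\<^esub> p = b' \<otimes>\<^bsub>G\<^esub> x [^]\<^bsub>G\<^esub> p'"
    for b b' and p p' :: int
  proof -
    have "x [^]\<^bsub>G\<^esub> p = inv\<^bsub>G\<^esub> b \<otimes>\<^bsub>G\<^esub> (b' \<otimes>\<^bsub>G\<^esub> x [^]\<^bsub>G\<^esub> p')"
      using b x_closed by (simp flip: eq G.m_assoc)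
    then have "x [^]\<^bsub>G\<^esub> (p - p') = inv\<^bsub>G\<^esub> b \<otimes>\<^bsub>G\<^esub> b'"
      using b x_closed by (simp add: G.int_pow_diff G.m_assoc)
    then have "x [^]\<^bsub>G\<^esub> (p - p') \<in> B" using b by simp
    then show ?thesis using x_power_in_B[of "p - p'"] by simp
  qed
  have "finite {p::int. \<exists>b \<in> B. b \<otimes>\<^bsub>G\<^esub> x [^]\<^bsub>G\<^esub> p = c}" for c
  proof (cases "\<exists>p::int. \<exists>b \<in> B. b \<otimes>\<^bsub>G\<^esub> x [^]\<^bsub>G\<^esub> p = c")
    case True
    then obtain p :: int and b where "b \<in> B" "b \<otimes>\<^bsub>G\<^esub> x [^]\<^bsub>G\<^esub> p = c" by blast
    then have "{p::int. \<exists>b \<in> B. b \<otimes>\<^bsub>G\<^esub> x [^]\<^bsub>G\<^esub> p = c} \<subseteq> {p}"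
      using uniq by blast
    then show ?thesis by (rule finite_subset) simp
  qed simp
  then have "finite (\<Union>c\<in>C. {p::int. \<exists>b \<in> B. b \<otimes>\<^bsub>G\<^esub> x [^]\<^bsub>G\<^esub> p = c})"
    using assms(1) by blast
  then show ?thesis by (rule rev_finite_subset) blast
qed

text \<open>Let \<open>e\<close> be the sum over \<open>H n\<close>, and let \<open>w = (1 - x)u = (1 - a)v\<close>. For \<open>0 < \<bar>p\<bar> \<le> n\<close> the
  second description of \<open>w\<close> gives \<open>ex\<^sup>pw = e(1 - b)x\<^sup>pv = 0\<close>, where \<open>b = x\<^sup>pax\<^sup>-\<^sup>p \<in> H n\<close>. By the first
  one, \<open>ex\<^sup>pw = U p - U (p + 1)\<close> for \<open>U p = ex\<^sup>pu\<close>. Hence \<open>U\<close> is constant on \<open>{1..n + 1}\<close> and on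
  \<open>{-n..0}\<close>, and \<open>ew = U 0 - U 1 = U (-n) - U (n + 1)\<close>. The left-hand side is supported on the cosets
  \<open>Bg\<close> with \<open>g\<close> in the support of \<open>w\<close>, the right-hand side on \<open>Bx\<^sup>-\<^sup>ng'\<close> and \<open>Bx\<^sup>n\<^sup>+\<^sup>1g'\<close> with \<open>g'\<close> in the
  support of \<open>u\<close>. Both supports being finite, these cosets are disjoint for large \<open>n\<close>, so \<open>ew = 0\<close>.\<close>

lemma subset_sum_annihilates_intersection:
  assumes u: "u \<in> carrier kG" and v: "v \<in> carrier kG"
    and w_u: "w = one_minus x \<otimes>\<^bsub>kG\<^esub> u" and w_v: "w = one_minus a \<otimes>\<^bsub>kG\<^esub> v"
  shows "\<exists>n0. \<forall>n\<ge>n0. subset_sum (H n) \<otimes>\<^bsub>kG\<^esub> w = \<zero>\<^bsub>kG\<^esub>"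
proof -
  interpret B: subgroup B G by (rule B_subgroup)
  have w: "w \<in> carrier kG" using u by (simp add: w_u)
  define C where "C = (\<lambda>(g, g'). g \<otimes>\<^bsub>G\<^esub> inv\<^bsub>G\<^esub> g') `
    ({g \<in> carrier G. w g \<noteq> \<zero>\<^bsub>k\<^esub>} \<times> {g \<in> carrier G. u g \<noteq> \<zero>\<^bsub>k\<^esub>})"
  have "finite C" "C \<subseteq> carrier G"
    using u w by (auto simp: C_def finite_support)
  then have "finite {p::int. \<exists>b \<in> B. b \<otimes>\<^bsub>G\<^esub> x [^]\<^bsub>G\<^esub> p \<in> C}"
    by (rule finite_powers_in_B_coset)
  then have "finite (abs ` {p::int. \<exists>b \<in> B. b \<otimes>\<^bsub>G\<^esub> x [^]\<^bsub>G\<^esub> p \<in> C})"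
    by (rule finite_imageI)
  then obtain m where m: "\<forall>p \<in> abs ` {p::int. \<exists>b \<in> B. b \<otimes>\<^bsub>G\<^esub> x [^]\<^bsub>G\<^esub> p \<in> C}. p \<le> m"
    using bdd_above_finite[unfolded bdd_above_def] by blast
  define n0 where "n0 = m + 1"
  have n0: "\<bar>p\<bar> < n0" if "b \<in> B" "b \<otimes>\<^bsub>G\<^esub> x [^]\<^bsub>G\<^esub> p \<in> C" for p :: int and b
    using m that by (force simp: n0_def)
  show ?thesis
  proof (intro exI allI impI)
    fix n assume n: "nat n0 \<le> n"
    define e where "e = subset_sum (H n)"
    have e: "e \<in> carrier kG" by (simp add: e_def subset_sum_closed H_finite)
    interpret H: subgroup "H n" G by (rule H_subgroup)
    define U where "U p = e \<otimes>\<^bsub>kG\<^esub> (\<delta> (x [^]\<^bsub>G\<^esub> p) \<otimes>\<^bsub>kG\<^esub> u)" for p :: int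
    have U: "U p \<in> carrier kG" for p using e u by (simp add: U_def)
    have diff: "e \<otimes>\<^bsub>kG\<^esub> (\<delta> (x [^]\<^bsub>G\<^esub> p) \<otimes>\<^bsub>kG\<^esub> w) = U p \<ominus>\<^bsub>kG\<^esub> U (p + 1)" for p :: int
    proof -
      have "\<delta> (x [^]\<^bsub>G\<^esub> p) \<otimes>\<^bsub>kG\<^esub> (\<delta> x \<otimes>\<^bsub>kG\<^esub> u) = \<delta> (x [^]\<^bsub>G\<^esub> (p + 1)) \<otimes>\<^bsub>kG\<^esub> u"
        using x_closed u by (simp add: group_ring_of_mult G.int_pow_mult G.int_pow_1)
      then show ?thesis
        using e u unfolding U_def w_u one_minus_mult[OF u]
        by (simp add: kG.minus_eq kG.r_distr kG.r_minus)
    qed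
    have zero: "e \<otimes>\<^bsub>kG\<^esub> (\<delta> (x [^]\<^bsub>G\<^esub> p) \<otimes>\<^bsub>kG\<^esub> w) = \<zero>\<^bsub>kG\<^esub>"
      if p: "p \<noteq> 0" "\<bar>p\<bar> \<le> int n" for p :: int
    proof -
      define b where "b = x [^]\<^bsub>G\<^esub> p \<otimes>\<^bsub>G\<^esub> a \<otimes>\<^bsub>G\<^esub> inv\<^bsub>G\<^esub> (x [^]\<^bsub>G\<^esub> p)"
      have b: "b \<in> H n" unfolding b_def by (rule conj_in_H) fact+
      have "\<delta> (x [^]\<^bsub>G\<^esub> p) \<otimes>\<^bsub>kG\<^esub> (\<delta> a \<otimes>\<^bsub>kG\<^esub> v) = \<delta> b \<otimes>\<^bsub>kG\<^esub> (\<delta> (x [^]\<^bsub>G\<^esub> p) \<otimes>\<^bsub>kG\<^esub> v)"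
        using b v x_closed a_closed by (simp add: group_ring_of_mult b_def G.m_assoc)
      then show ?thesis
        using e v subset_sum_absorb[OF H_subgroup H_finite b, of "\<delta> (x [^]\<^bsub>G\<^esub> p) \<otimes>\<^bsub>kG\<^esub> v"]
        unfolding w_v one_minus_mult[OF v]
        by (simp add: kG.minus_eq kG.r_distr kG.r_minus kG.r_neg flip: e_def)
    qed
    have step: "U p = U (p + 1)" if "p \<noteq> 0" "\<bar>p\<bar> \<le> int n" for p :: int
      using diff[of p, symmetric] unfolding zero[OF that] kG.r_right_minus_eq[OF U U] .
    have right: "U (int m + 1) = U 1" if "m \<le> n" for m
      using that
    proof (induction m)
      case (Suc m)
      then show ?case using step[of "int (Suc m)"] by (simp add: add.commute)
    qed simp
    have left: "U (- int m) = U 0" if "m \<le> n" for m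
      using that
    proof (induction m)
      case (Suc m)
      then show ?case using step[of "- int (Suc m)"] by simp
    qed simp
    have "e \<otimes>\<^bsub>kG\<^esub> w = U 0 \<ominus>\<^bsub>kG\<^esub> U 1"
      using diff[of 0] w by (simp add: group_ring_of_one)
    then have ew: "e \<otimes>\<^bsub>kG\<^esub> w = U (- int n) \<ominus>\<^bsub>kG\<^esub> U (int n + 1)"
      by (simp add: left right)
    \<comment> \<open>If \<open>y = hg = h'x\<^sup>pg'\<close> is a common point of the supports, then \<open>h\<inverse>h'x\<^sup>p = gg'\<inverse> \<in> C\<close>, which bounds \<open>p\<close>.\<close>
    have disjoint: "U p y = \<zero>\<^bsub>k\<^esub>"
      if y: "y \<in> carrier G" and wy: "(e \<otimes>\<^bsub>kG\<^esub> w) y \<noteq> \<zero>\<^bsub>k\<^esub>" and p: "n0 \<le> \<bar>p\<bar>" for y p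
    proof (rule ccontr)
      assume Uy: "U p y \<noteq> \<zero>\<^bsub>k\<^esub>"
      obtain h where h: "h \<in> H n" "w (inv\<^bsub>G\<^esub> h \<otimes>\<^bsub>G\<^esub> y) \<noteq> \<zero>\<^bsub>k\<^esub>"
        by (rule subset_sum_mult_apply_nonzeroE[OF H_finite H.subset w y wy[unfolded e_def]])
      obtain h' where h': "h' \<in> H n" "(\<delta> (x [^]\<^bsub>G\<^esub> p) \<otimes>\<^bsub>kG\<^esub> u) (inv\<^bsub>G\<^esub> h' \<otimes>\<^bsub>G\<^esub> y) \<noteq> \<zero>\<^bsub>k\<^esub>"
        by (rule subset_sum_mult_apply_nonzeroE
            [OF H_finite H.subset kG.m_closed[OF group_ring_of_closed u] y Uy[unfolded U_def e_def]])
      define g where "g = inv\<^bsub>G\<^esub> h \<otimes>\<^bsub>G\<^esub> y"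
      define g' where "g' = inv\<^bsub>G\<^esub> (x [^]\<^bsub>G\<^esub> p) \<otimes>\<^bsub>G\<^esub> (inv\<^bsub>G\<^esub> h' \<otimes>\<^bsub>G\<^esub> y)"
      have g: "g \<in> carrier G" "g' \<in> carrier G" "w g \<noteq> \<zero>\<^bsub>k\<^esub>" "u g' \<noteq> \<zero>\<^bsub>k\<^esub>"
        using h h' y x_closed u by (simp_all add: g_def g'_def group_ring_of_mult_apply)
      have "g \<otimes>\<^bsub>G\<^esub> inv\<^bsub>G\<^esub> g' = (inv\<^bsub>G\<^esub> h \<otimes>\<^bsub>G\<^esub> h') \<otimes>\<^bsub>G\<^esub> x [^]\<^bsub>G\<^esub> p"
      proof -
        have "y \<otimes>\<^bsub>G\<^esub> (inv\<^bsub>G\<^esub> y \<otimes>\<^bsub>G\<^esub> c) = c" if "c \<in> carrier G" for c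
          using y that by (simp flip: G.m_assoc)
        then show ?thesis
          using h h' y x_closed by (simp add: g_def g'_def G.inv_mult_group G.m_assoc)
      qed
      moreover have "g \<otimes>\<^bsub>G\<^esub> inv\<^bsub>G\<^esub> g' \<in> C" using g by (auto simp: C_def)
      moreover have "inv\<^bsub>G\<^esub> h \<otimes>\<^bsub>G\<^esub> h' \<in> B" using h h' H_sub_B by blast
      ultimately show False using n0[of "inv\<^bsub>G\<^esub> h \<otimes>\<^bsub>G\<^esub> h'" p] p by simp
    qed
    have "(e \<otimes>\<^bsub>kG\<^esub> w) y = \<zero>\<^bsub>k\<^esub>" if y: "y \<in> carrier G" for y
    proof (rule ccontr)
      assume ne: "(e \<otimes>\<^bsub>kG\<^esub> w) y \<noteq> \<zero>\<^bsub>k\<^esub>"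
      have "(e \<otimes>\<^bsub>kG\<^esub> w) y = U (- int n) y \<ominus>\<^bsub>k\<^esub> U (int n + 1) y"
        unfolding ew by (rule minus_apply) (use U y in auto)
      also have "\<dots> = \<zero>\<^bsub>k\<^esub>"
        using disjoint[OF y ne, of "- int n"] disjoint[OF y ne, of "int n + 1"] n
        by (simp add: k.minus_eq)
      finally show False using ne by simp
    qed
    then show "subset_sum (H n) \<otimes>\<^bsub>kG\<^esub> w = \<zero>\<^bsub>kG\<^esub>"
      using e w unfolding e_def[symmetric] by (intro group_ring_eqI) (simp_all add: zero_apply)
  qed
qed

text \<open>If \<open>Q\<close> were flat, \<open>1 - a\<close> would be a finite sum of elements \<open>wq\<close> with
  \<open>w \<in> (1 - x)kG \<inter> (1 - a)kG\<close>. The sum over \<open>H n\<close> annihilates each of them from the left for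
  large \<open>n\<close>, but it never annihilates \<open>1 - a\<close>.\<close>

lemma not_flat:
  fixes Q :: "('q, 'z) ring_scheme"
  assumes "ring Q" and \<phi>: "\<phi> \<in> ring_hom kG Q" and inj: "inj_on \<phi> (carrier kG)"
    and unit: "\<phi> (one_minus x) \<in> Units Q"
  shows "\<not> flat_module TYPE('g \<Rightarrow> 'k) kG (restrict_scalars \<phi> Q)"
proof
  assume flat: "flat_module TYPE('g \<Rightarrow> 'k) kG (restrict_scalars \<phi> Q)"
  interpret Q: ring Q by fact
  interpret \<phi>: ring_hom_ring kG Q \<phi>
    by (rule ring_hom_ringI2) (fact kG.ring_axioms, fact+)
  define E where "E n = \<phi> (subset_sum (H n))" for n
  have E [simp]: "E n \<in> carrier Q" for n
    by (simp add: E_def subset_sum_closed H_finite)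
  \<comment> \<open>A bound \<open>n0\<close> may depend on \<open>q\<close>; the condition for all large \<open>n\<close> is preserved by sums.\<close>
  define K where "K = {q \<in> carrier Q. \<exists>n0. \<forall>n\<ge>n0. E n \<otimes>\<^bsub>Q\<^esub> q = \<zero>\<^bsub>Q\<^esub>}"
  define D where "D = {\<phi> w \<otimes>\<^bsub>Q\<^esub> q | w q.
    w \<in> (one_minus x <#\<^bsub>kG\<^esub> carrier kG) \<inter> (one_minus a <#\<^bsub>kG\<^esub> carrier kG) \<and> q \<in> carrier Q}"
  have om: "one_minus g \<in> carrier kG" for g by simp
  have "\<phi> (one_minus a) \<in> generate (add_monoid Q) D"
    unfolding D_def
    by (rule flat_imp_mem_extended_intersection[OF \<open>ring Q\<close> \<phi> flat, OF _ _ _ _ unit])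
      (rule kG.right_ideal_principal[OF om])+
  also have "\<dots> \<subseteq> K"
  proof (rule Q.add.generate_subgroup_incl)
    show "D \<subseteq> K"
    proof
      fix d assume "d \<in> D"
      then obtain w q u v where d: "d = \<phi> w \<otimes>\<^bsub>Q\<^esub> q" "q \<in> carrier Q"
        and u: "u \<in> carrier kG" "w = one_minus x \<otimes>\<^bsub>kG\<^esub> u"
        and v: "v \<in> carrier kG" "w = one_minus a \<otimes>\<^bsub>kG\<^esub> v"
        unfolding D_def l_coset_def by blast
      have w: "w \<in> carrier kG" using u by simp
      obtain n0 where "\<And>n. n \<ge> n0 \<Longrightarrow> subset_sum (H n) \<otimes>\<^bsub>kG\<^esub> w = \<zero>\<^bsub>kG\<^esub>"
        using subset_sum_annihilates_intersection[OF u(1) v(1) u(2) v(2)] by blast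
      then have "E n \<otimes>\<^bsub>Q\<^esub> \<phi> w = \<zero>\<^bsub>Q\<^esub>" if "n \<ge> n0" for n
        using that w \<phi>.hom_mult[of "subset_sum (H n)" w]
        by (simp add: E_def subset_sum_closed H_finite)
      then have "\<forall>n\<ge>n0. E n \<otimes>\<^bsub>Q\<^esub> d = \<zero>\<^bsub>Q\<^esub>"
        using w d by (simp flip: Q.m_assoc)
      then show "d \<in> K" using d w by (auto simp: K_def)
    qed
    show "subgroup K (add_monoid Q)"
    proof (rule Q.add.subgroupI)
      fix p q assume "p \<in> K" "q \<in> K"
      then obtain n1 n2 where pq: "p \<in> carrier Q" "q \<in> carrier Q"
        "\<forall>n\<ge>n1. E n \<otimes>\<^bsub>Q\<^esub> p = \<zero>\<^bsub>Q\<^esub>" "\<forall>n\<ge>n2. E n \<otimes>\<^bsub>Q\<^esub> q = \<zero>\<^bsub>Q\<^esub>"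
        by (auto simp: K_def)
      then have "\<forall>n\<ge>max n1 n2. E n \<otimes>\<^bsub>Q\<^esub> (p \<oplus>\<^bsub>Q\<^esub> q) = \<zero>\<^bsub>Q\<^esub>"
        by (simp add: Q.r_distr)
      then show "p \<oplus>\<^bsub>Q\<^esub> q \<in> K"
        using pq(1,2) unfolding K_def by blast
    next
      have "\<zero>\<^bsub>Q\<^esub> \<in> K" by (simp add: K_def)
      then show "K \<noteq> {}" by blast
    next
      fix q assume "q \<in> K"
      then show "\<ominus>\<^bsub>Q\<^esub> q \<in> K" by (auto simp: K_def Q.r_minus)
    qed (auto simp: K_def)
  qed
  finally obtain n where "E n \<otimes>\<^bsub>Q\<^esub> \<phi> (one_minus a) = \<zero>\<^bsub>Q\<^esub>"
    by (auto simp: K_def)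
  then have "\<phi> (subset_sum (H n) \<otimes>\<^bsub>kG\<^esub> one_minus a) = \<phi> \<zero>\<^bsub>kG\<^esub>"
    using om \<phi>.hom_mult[of "subset_sum (H n)" "one_minus a"]
    by (simp add: E_def subset_sum_closed H_finite del: \<phi>.hom_mult)
  then have "subset_sum (H n) \<otimes>\<^bsub>kG\<^esub> one_minus a = \<zero>\<^bsub>kG\<^esub>"
    by (rule inj_onD[OF inj]) (simp_all add: subset_sum_closed H_finite)
  then show False using subset_sum_mult_one_minus_nonzero by blast
qed

end

section \<open>Wreath products with the integers\<close>

definition lamp :: "('a, 'x) monoid_scheme \<Rightarrow> 'a \<Rightarrow> int \<Rightarrow> 'a"
  where "lamp A a = (\<lambda>i. if i = 0 then a else \<one>\<^bsub>A\<^esub>)"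

definition trivial_on :: "('a, 'x) monoid_scheme \<Rightarrow> int set \<Rightarrow> (int \<Rightarrow> 'a) set"
  where "trivial_on A I = {b \<in> carrier (wreath_base A). \<forall>i \<in> I. b i = \<one>\<^bsub>A\<^esub>}"

lemma group_wreath_base: "group A \<Longrightarrow> group (wreath_base A)"
  by (simp add: wreath_base_def)

lemma wreath_base_one: "\<one>\<^bsub>wreath_base A\<^esub> = (\<lambda>i. \<one>\<^bsub>A\<^esub>)"
  by (simp add: wreath_base_def restrict_def)

lemma wreath_base_mult: "b \<otimes>\<^bsub>wreath_base A\<^esub> c = (\<lambda>i. b i \<otimes>\<^bsub>A\<^esub> c i)"
  by (simp add: wreath_base_def restrict_def)

lemma wreath_base_inv:
  "group A \<Longrightarrow> b \<in> carrier (wreath_base A) \<Longrightarrow> inv\<^bsub>wreath_base A\<^esub> b = (\<lambda>i. inv\<^bsub>A\<^esub> b i)"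
  by (simp add: wreath_base_def restrict_def)

lemma wreath_int_mult:
  "(b, m) \<otimes>\<^bsub>wreath_int A\<^esub> (c, n) = (b \<otimes>\<^bsub>wreath_base A\<^esub> wreath_shift m c, m + n)"
  by (simp add: wreath_int_def semidirect_product_def)

lemma wreath_int_carrier: "(b, m) \<in> carrier (wreath_int A) \<longleftrightarrow> b \<in> carrier (wreath_base A)"
  by (simp add: wreath_int_def semidirect_product_def)

lemma lamp_closed: "group A \<Longrightarrow> a \<in> carrier A \<Longrightarrow> lamp A a \<in> carrier (wreath_base A)"
  by (auto simp: carrier_wreath_base lamp_def intro: monoid.one_closed group.is_monoid)

lemma trivial_on_subgroup:
  assumes "group A"
  shows "subgroup (trivial_on A I) (wreath_base A)"
proof -
  interpret A: group A by fact
  interpret B: group "wreath_base A" by (rule group_wreath_base) fact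
  show ?thesis
  proof (rule B.subgroupI)
    show "trivial_on A I \<noteq> {}"
      using B.one_closed by (auto simp: trivial_on_def wreath_base_one)
  next
    fix b assume "b \<in> trivial_on A I"
    then show "inv\<^bsub>wreath_base A\<^esub> b \<in> trivial_on A I"
      using B.inv_closed[of b] by (auto simp: trivial_on_def wreath_base_inv[OF assms])
  next
    fix b c assume "b \<in> trivial_on A I" "c \<in> trivial_on A I"
    then show "b \<otimes>\<^bsub>wreath_base A\<^esub> c \<in> trivial_on A I"
      using B.m_closed[of b c] by (auto simp: trivial_on_def wreath_base_mult)
  qed (auto simp: trivial_on_def)
qed

lemma finite_trivial_on:
  assumes "group A" "finite (carrier A)" "finite (- I)"
  shows "finite (trivial_on A I)"
proof (rule finite_subset)
  show "trivial_on A I \<subseteq> {b. \<forall>i. (i \<in> - I \<longrightarrow> b i \<in> carrier A) \<and> (i \<notin> - I \<longrightarrow> b i = \<one>\<^bsub>A\<^esub>)}"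
    using assms(1) by (auto simp: trivial_on_def carrier_wreath_base)
  show "finite {b. \<forall>i. (i \<in> - I \<longrightarrow> b i \<in> carrier A) \<and> (i \<notin> - I \<longrightarrow> b i = \<one>\<^bsub>A\<^esub>)}"
    using assms by (intro finite_set_of_finite_funs)
qed

lemma wreath_base_embedding:
  "(\<lambda>b. (b, 0)) \<in> hom (wreath_base A) (wreath_int A)"
  by (rule homI) (simp_all add: wreath_int_carrier wreath_int_mult wreath_shift_def)

lemma wreath_shift_one: "wreath_shift m \<one>\<^bsub>wreath_base A\<^esub> = \<one>\<^bsub>wreath_base A\<^esub>"
  by (simp add: wreath_base_one wreath_shift_def)

lemma wreath_int_embedding:
  assumes "group A"
  shows "(\<lambda>m. (\<one>\<^bsub>wreath_base A\<^esub>, m)) \<in> hom integer_group (wreath_int A)"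
proof -
  interpret B: group "wreath_base A" by (rule group_wreath_base) fact
  show ?thesis
    by (rule homI) (simp_all add: wreath_int_carrier wreath_int_mult wreath_shift_one)
qed

lemma wreath_int_conj:
  fixes m :: int
  assumes "group A" and b: "b \<in> carrier (wreath_base A)"
  defines "t \<equiv> (\<one>\<^bsub>wreath_base A\<^esub>, m)"
  shows "t \<otimes>\<^bsub>wreath_int A\<^esub> (b, 0) \<otimes>\<^bsub>wreath_int A\<^esub> inv\<^bsub>wreath_int A\<^esub> t = (wreath_shift m b, 0)"
proof -
  interpret B: group "wreath_base A" by (rule group_wreath_base) fact
  interpret W: group "wreath_int A" by (rule group_wreath_int) fact
  have shift: "wreath_shift m b \<in> carrier (wreath_base A)"
    using assms by (simp add: wreath_shift_closed)
  have "t \<otimes>\<^bsub>wreath_int A\<^esub> (b, 0) = (wreath_shift m b, 0) \<otimes>\<^bsub>wreath_int A\<^esub> t"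
    using shift by (simp add: t_def wreath_int_mult wreath_shift_one)
  then show ?thesis
    using shift by (simp add: t_def wreath_int_carrier W.m_assoc)
qed

text \<open>As \<open>z = \<plusminus>1\<close>, conjugation by the \<open>p\<close>-th power of the generator moves the lamp at \<open>0\<close> to \<open>pz\<close>, and
  \<open>\<bar>pz\<bar> = \<bar>p\<bar>\<close>. So the conjugates with \<open>0 < \<bar>p\<bar> \<le> n\<close> are trivial at \<open>0\<close> and outside \<open>[-n, n]\<close>.
  Finiteness of \<open>A\<close> makes the group of all such states finite.\<close>

lemma lamplighter_configuration_wreath:
  fixes k :: "('k, 'y) ring_scheme" and G :: "('g, 'x) monoid_scheme"
    and A :: "('a, 'w) monoid_scheme"
  assumes "ring k" "\<one>\<^bsub>k\<^esub> \<noteq> \<zero>\<^bsub>k\<^esub>" "group G"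
    and "group A" "finite (carrier A)" and a: "a \<in> carrier A" "a \<noteq> \<one>\<^bsub>A\<^esub>"
    and \<psi>: "\<psi> \<in> mon (wreath_int A) G" and z: "\<bar>z\<bar> = 1"
  shows "lamplighter_configuration k G (\<psi> (\<one>\<^bsub>wreath_base A\<^esub>, z)) (\<psi> (lamp A a, 0))
    ((\<lambda>b. \<psi> (b, 0)) ` carrier (wreath_base A))
    (\<lambda>n. (\<lambda>b. \<psi> (b, 0)) ` trivial_on A {i. i = 0 \<or> int n < \<bar>i\<bar>})"
proof -
  define W where "W = wreath_int A"
  interpret k: ring k by fact
  interpret A: group A by fact
  interpret B: group "wreath_base A" by (rule group_wreath_base) fact
  interpret W: group W unfolding W_def by (rule group_wreath_int) fact
  interpret G: group G by fact
  have \<psi>_hom: "\<psi> \<in> hom W G" and inj: "inj_on \<psi> (carrier W)"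
    using \<psi> by (simp_all add: mon_def W_def)
  interpret psi: group_hom W G \<psi>
    by unfold_locales (rule \<psi>_hom)
  have W_carrier: "(b, m) \<in> carrier W \<longleftrightarrow> b \<in> carrier (wreath_base A)" for b m
    by (simp add: W_def wreath_int_carrier)
  have \<beta>_hom: "(\<lambda>b. \<psi> (b, 0)) \<in> hom (wreath_base A) G"
    using hom_compose[OF wreath_base_embedding \<psi>_hom[unfolded W_def]]
    by (simp add: comp_def)
  interpret \<beta>: group_hom "wreath_base A" G "\<lambda>b. \<psi> (b, 0)"
    by unfold_locales (rule \<beta>_hom)
  interpret \<iota>: group_hom integer_group W "\<lambda>m. (\<one>\<^bsub>wreath_base A\<^esub>, m)"
    by (intro group_hom.intro group_hom_axioms.intro W.is_group)
      (simp_all add: W_def wreath_int_embedding[OF \<open>group A\<close>])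
  have lamp: "lamp A a \<in> carrier (wreath_base A)"
    using \<open>group A\<close> a(1) by (rule lamp_closed)
  have pow: "\<psi> (\<one>\<^bsub>wreath_base A\<^esub>, z) [^]\<^bsub>G\<^esub> p = \<psi> (\<one>\<^bsub>wreath_base A\<^esub>, p * z)" for p :: int
    using psi.hom_int_pow[of "(\<one>\<^bsub>wreath_base A\<^esub>, z)" p] \<iota>.hom_int_pow[of z p]
    by (simp add: W_carrier)
  show ?thesis
  proof (intro lamplighter_configuration.intro lamplighter_configuration_axioms.intro
      group_algebra.intro group_algebra_axioms.intro)
    show "subgroup ((\<lambda>b. \<psi> (b, 0)) ` carrier (wreath_base A)) G"
      by (rule \<beta>.subgroup_img_is_subgroup[OF B.subgroup_self])
    show "subgroup ((\<lambda>b. \<psi> (b, 0)) ` trivial_on A {i. i = 0 \<or> int n < \<bar>i\<bar>}) G" for n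
      by (rule \<beta>.subgroup_img_is_subgroup[OF trivial_on_subgroup[OF \<open>group A\<close>]])
    show "(\<lambda>b. \<psi> (b, 0)) ` trivial_on A {i. i = 0 \<or> int n < \<bar>i\<bar>} \<subseteq>
        (\<lambda>b. \<psi> (b, 0)) ` carrier (wreath_base A)" for n
      by (auto simp: trivial_on_def)
  next
    fix p :: int
    assume "\<psi> (\<one>\<^bsub>wreath_base A\<^esub>, z) [^]\<^bsub>G\<^esub> p \<in> (\<lambda>b. \<psi> (b, 0)) ` carrier (wreath_base A)"
    then obtain b where "b \<in> carrier (wreath_base A)" "\<psi> (\<one>\<^bsub>wreath_base A\<^esub>, p * z) = \<psi> (b, 0)"
      by (auto simp: pow)
    then have "(\<one>\<^bsub>wreath_base A\<^esub>, p * z) = (b, 0)"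
      by (intro inj_onD[OF inj]) (simp_all add: W_carrier)
    then show "p = 0" using z by auto
  next
    fix p :: int and n assume p: "p \<noteq> 0" "\<bar>p\<bar> \<le> int n"
    define t where "t = (\<one>\<^bsub>wreath_base A\<^esub>, p * z)"
    have t: "t \<in> carrier W" "(lamp A a, 0) \<in> carrier W" using lamp by (simp_all add: t_def W_carrier)
    have "\<psi> t \<otimes>\<^bsub>G\<^esub> \<psi> (lamp A a, 0) \<otimes>\<^bsub>G\<^esub> inv\<^bsub>G\<^esub> (\<psi> t) =
        \<psi> (t \<otimes>\<^bsub>W\<^esub> (lamp A a, 0) \<otimes>\<^bsub>W\<^esub> inv\<^bsub>W\<^esub> t)"
      using t by simp
    also have "\<dots> = \<psi> (wreath_shift (p * z) (lamp A a), 0)"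
      using wreath_int_conj[OF \<open>group A\<close> lamp, of "p * z"] by (simp add: t_def W_def)
    finally have "\<psi> t \<otimes>\<^bsub>G\<^esub> \<psi> (lamp A a, 0) \<otimes>\<^bsub>G\<^esub> inv\<^bsub>G\<^esub> (\<psi> t) =
        \<psi> (wreath_shift (p * z) (lamp A a), 0)" .
    moreover have "wreath_shift (p * z) (lamp A a) \<in> trivial_on A {i. i = 0 \<or> int n < \<bar>i\<bar>}"
    proof -
      have "\<bar>p * z\<bar> = \<bar>p\<bar>" using z by (simp add: abs_mult)
      then have "p * z \<noteq> 0" "\<bar>p * z\<bar> \<le> int n" using p by auto
      then show ?thesis
        using wreath_shift_closed[OF \<open>group A\<close> lamp, of "p * z"]
        by (auto simp: trivial_on_def) (auto simp: wreath_shift_def lamp_def)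
    qed
    ultimately show "\<psi> (\<one>\<^bsub>wreath_base A\<^esub>, z) [^]\<^bsub>G\<^esub> p \<otimes>\<^bsub>G\<^esub> \<psi> (lamp A a, 0) \<otimes>\<^bsub>G\<^esub>
        inv\<^bsub>G\<^esub> (\<psi> (\<one>\<^bsub>wreath_base A\<^esub>, z) [^]\<^bsub>G\<^esub> p)
        \<in> (\<lambda>b. \<psi> (b, 0)) ` trivial_on A {i. i = 0 \<or> int n < \<bar>i\<bar>}"
      by (simp add: pow t_def)
  next
    fix n
    show "finite ((\<lambda>b. \<psi> (b, 0)) ` trivial_on A {i. i = 0 \<or> int n < \<bar>i\<bar>})"
    proof (intro finite_imageI finite_trivial_on)
      show "finite (- {i. i = 0 \<or> int n < \<bar>i\<bar>})"
        by (rule finite_subset[of _ "{- int n..int n}"]) auto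
    qed fact+
    show "\<psi> (lamp A a, 0) \<notin> (\<lambda>b. \<psi> (b, 0)) ` trivial_on A {i. i = 0 \<or> int n < \<bar>i\<bar>}"
    proof
      assume "\<psi> (lamp A a, 0) \<in> (\<lambda>b. \<psi> (b, 0)) ` trivial_on A {i. i = 0 \<or> int n < \<bar>i\<bar>}"
      then obtain b where b: "b \<in> carrier (wreath_base A)" "b 0 = \<one>\<^bsub>A\<^esub>" "\<psi> (lamp A a, 0) = \<psi> (b, 0)"
        by (auto simp: trivial_on_def)
      then have "(lamp A a, 0 :: int) = (b, 0)"
        using lamp by (intro inj_onD[OF inj]) (simp_all add: W_carrier)
      then show False using b(2) a(2) by (auto simp: lamp_def)
    qed
  qed (use lamp in \<open>simp_all add: W_carrier k.ring_axioms G.is_group assms(2)\<close>)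
qed

lemma integer_group_generator:
  assumes "generate integer_group {z} = carrier integer_group"
  shows "\<bar>z\<bar> = 1"
proof -
  have "1 \<in> generate integer_group {z}" by (simp add: assms)
  then obtain j :: int where "1 = j * z"
    using group.generate_pow[OF group_integer_group, of z] by auto
  then have "z dvd 1" by (metis dvd_triv_right)
  then show ?thesis by simp
qed

section \<open>Failure of flatness\<close>

theorem corollary16:
  fixes d :: nat
    and G :: "('g, 'x) monoid_scheme"
    and k :: "('k, 'y) ring_scheme"
    and Q :: "('q, 'z) ring_scheme"
    and \<psi> :: "(int \<Rightarrow> int) \<times> int \<Rightarrow> 'g"
    and \<phi> :: "('g \<Rightarrow> 'k) \<Rightarrow> 'q"
    and z :: int and x :: 'g
  assumes "d \<ge> 2"
    and "group G"
    and "\<psi> \<in> mon (wreath_int (integer_mod_group d)) G"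
    and "generate integer_group {z} = carrier integer_group"
    and "x = \<psi> (\<one>\<^bsub>wreath_base (integer_mod_group d)\<^esub>, z)"
    and "cring k" and "\<one>\<^bsub>k\<^esub> \<noteq> \<zero>\<^bsub>k\<^esub>"
    and "ring Q"
    and "\<phi> \<in> ring_hom (group_ring k G) Q"
    and "inj_on \<phi> (carrier (group_ring k G))"
    and "\<phi> (\<one>\<^bsub>group_ring k G\<^esub> \<ominus>\<^bsub>group_ring k G\<^esub> group_ring_of k G x) \<in> Units Q"
  shows "\<not> flat_module TYPE('g \<Rightarrow> 'k) (group_ring k G) (restrict_scalars \<phi> Q)"
proof -
  have "ring k" using \<open>cring k\<close> by (rule cring.axioms)
  have "finite (carrier (integer_mod_group d))" "1 \<in> carrier (integer_mod_group d)"
    "1 \<noteq> \<one>\<^bsub>integer_mod_group d\<^esub>"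
    using \<open>d \<ge> 2\<close> by (simp_all add: carrier_integer_mod_group)
  \<comment> \<open>Any nontrivial state will do for the lamp at \<open>0\<close>; here it is the residue class of \<open>1\<close>.\<close>
  then have "lamplighter_configuration k G x (\<psi> (lamp (integer_mod_group d) 1, 0))
      ((\<lambda>b. \<psi> (b, 0)) ` carrier (wreath_base (integer_mod_group d)))
      (\<lambda>n. (\<lambda>b. \<psi> (b, 0)) ` trivial_on (integer_mod_group d) {i. i = 0 \<or> int n < \<bar>i\<bar>})"
    unfolding \<open>x = _\<close>
    by (intro lamplighter_configuration_wreath integer_group_generator group_integer_mod_group
        \<open>ring k\<close> assms)
  then show ?thesis
    by (rule lamplighter_configuration.not_flat) fact+
qed

end
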